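(* Let $t_0<t_f$ be real numbers, let $r<n$, $m$, $p$ be positive integers, and let $A:[t_0,t_f]\to\mathbb{R}^{n\times n}$, $B:[t_0,t_f]\to\mathbb{R}^{n\times m}$, $C:[t_0,t_f]\to\mathbb{R}^{p\times n}$ be continuous and bounded, defining the full-order linear time-varying system $\Sigma$: $\dot x=A(t)x+B(t)u$, $y=C(t)x$. For continuous and bounded $A_r:[t_0,t_f]\to\mathbb{R}^{r\times r}$, $B_r:[t_0,t_f]\to\mathbb{R}^{r\times m}$, $C_r:[t_0,t_f]\to\mathbb{R}^{p\times r}$, defining the reduced-order system $\Sigma_r$: $\dot x_r=A_r(t)x_r+B_r(t)u$, $y_r=C_r(t)x_r$, let $$J[A_r,B_r,C_r]=\left\Vert \Sigma-\Sigma_r\right\Vert_{H_2[t_0,t_f]}^2=\int_{t_0}^{t_f}\int_{t_0}^{t}\left\Vert h(t,\tau)-h_r(t,\tau)\right\Vert_F^2\,d\tau\,dt .$$ Then the functional derivatives of $J$ with respect to $A_r$, $B_r$ and $C_r$ at $(A_r,B_r,C_r)$ are, for $t\in[t_0,t_f]$, $$\frac{\partial J}{\partial A_r}(t)=2\left(Q_r(t)P_r(t)-Y(t)^{T}X(t)\right),$$ $$\frac{\partial J}{\partial B_r}(t)=2\left(Q_r(t)B_r(t)-Y(t)^{T}B(t)\right),$$ $$\frac{\partial J}{\partial C_r}(t)=2\left(C_r(t)P_r(t)-C(t)X(t)\right).$$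
   Context: $\phi(t,\tau)$ and $\phi_r(t,\tau)$ denote the state transition matrices of $A$ and $A_r$: $\frac{\partial}{\partial t}\phi(t,\tau)=A(t)\phi(t,\tau)$, $\phi(\tau,\tau)=I_n$, and $\frac{\partial}{\partial t}\phi_r(t,\tau)=A_r(t)\phi_r(t,\tau)$, $\phi_r(\tau,\tau)=I_r$, for $t,\tau\in[t_0,t_f]$. The impulse responses are $h(t,\tau)=C(t)\phi(t,\tau)B(\tau)$ and $h_r(t,\tau)=C_r(t)\phi_r(t,\tau)B_r(\tau)$ for $\tau\le t$, and both are $0$ for $t<\tau$. $\Vert\cdot\Vert_F$ is the Frobenius norm. For $t\in[t_0,t_f]$ define $P_r(t)=\int_{t_0}^{t}\phi_r(t,\tau)B_r(\tau)B_r(\tau)^{T}\phi_r(t,\tau)^{T}d\tau\in\mathbb{R}^{r\times r}$, $X(t)=\int_{t_0}^{t}\phi(t,\tau)B(\tau)B_r(\tau)^{T}\phi_r(t,\tau)^{T}d\tau\in\mathbb{R}^{n\times r}$, $Q_r(t)=\int_{t}^{t_f}\phi_r(\tau,t)^{T}C_r(\tau)^{T}C_r(\tau)\phi_r(\tau,t)d\tau\in\mathbb{R}^{r\times r}$, $Y(t)=\int_{t}^{t_f}\phi(\tau,t)^{T}C(\tau)^{T}C_r(\tau)\phi_r(\tau,t)d\tau\in\mathbb{R}^{n\times r}$. Functional derivative: let $M_i$ be the set of continuous bounded functions $[t_0,t_f]\to\mathbb{R}^{m_i\times n_i}$, $i=1,\dots,k$, and $F:M_1\times\dots\times M_k\to\mathbb{R}$.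 The functional derivative of $F$ with respect to $f_i$ is the function $\frac{\partial F}{\partial f_i}:[t_0,t_f]\to\mathbb{R}^{m_i\times n_i}$ satisfying, for every $\Delta f_i\in M_i$, $$\int_{t_0}^{t_f}\mathrm{Tr}\left(\left(\tfrac{\partial F}{\partial f_i}(t)\right)^{T}\Delta f_i(t)\right)dt=\lim_{\epsilon\to0}\frac{F[f_i+\epsilon\Delta f_i]-F[f_i]}{\epsilon},$$ where $\epsilon$ is a real scalar and all other arguments of $F$ are held fixed. *)

theory Defs
  imports "HOL-Analysis.Analysis"
begin

(* An a x b matrix has type real^'b^'a.  The library norm on this type is the square root of
   the sum of the squares of all entries, i.e. the Frobenius norm.
   Functions on [t0,tf] are total functions on the reals; all notions below depend only on
   their values on {t0..tf}. *)

definition cont_bdd :: "real \<Rightarrow> real \<Rightarrow> (real \<Rightarrow> real^'b^'a) set" where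
  "cont_bdd t0 tf = {f. continuous_on {t0..tf} f \<and> bounded (f ` {t0..tf})}"

definition is_transition_matrix ::
  "real \<Rightarrow> real \<Rightarrow> (real \<Rightarrow> real^'n^'n) \<Rightarrow> (real \<Rightarrow> real \<Rightarrow> real^'n^'n) \<Rightarrow> bool" where
  "is_transition_matrix t0 tf A \<phi> \<longleftrightarrow>
     (\<forall>\<tau>\<in>{t0..tf}. \<phi> \<tau> \<tau> = mat 1 \<and>
        (\<forall>t\<in>{t0..tf}. ((\<lambda>s. \<phi> s \<tau>) has_vector_derivative (A t ** \<phi> t \<tau>))
                        (at t within {t0..tf})))"

(* For continuous A the initial value problem determines the values on {t0..tf} x {t0..tf};
   the choice only affects irrelevant values outside this square. *)
definition transition_matrix ::
  "real \<Rightarrow> real \<Rightarrow> (real \<Rightarrow> real^'n^'n) \<Rightarrow> real \<Rightarrow> real \<Rightarrow> real^'n^'n" where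
  "transition_matrix t0 tf A = (SOME \<phi>. is_transition_matrix t0 tf A \<phi>)"

definition impulse_response ::
  "real \<Rightarrow> real \<Rightarrow> (real \<Rightarrow> real^'n^'n) \<Rightarrow> (real \<Rightarrow> real^'m^'n) \<Rightarrow> (real \<Rightarrow> real^'n^'p)
    \<Rightarrow> real \<Rightarrow> real \<Rightarrow> real^'m^'p" where
  "impulse_response t0 tf A B C t \<tau> =
     (if \<tau> \<le> t then C t ** transition_matrix t0 tf A t \<tau> ** B \<tau> else 0)"

(* The finite-horizon H2 norm of a linear system, in terms of its impulse response.
   The impulse response of a difference of systems is the difference of impulse responses. *)
definition H2_norm :: "real \<Rightarrow> real \<Rightarrow> (real \<Rightarrow> real \<Rightarrow> real^'m^'p) \<Rightarrow> real" where
  "H2_norm t0 tf g = sqrt (integral {t0..tf} (\<lambda>t. integral {t0..t} (\<lambda>\<tau>. (norm (g t \<tau>))\<^sup>2)))"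

definition H2_error ::
  "real \<Rightarrow> real \<Rightarrow> (real \<Rightarrow> real^'n^'n) \<Rightarrow> (real \<Rightarrow> real^'m^'n) \<Rightarrow> (real \<Rightarrow> real^'n^'p)
    \<Rightarrow> (real \<Rightarrow> real^'r^'r) \<Rightarrow> (real \<Rightarrow> real^'m^'r) \<Rightarrow> (real \<Rightarrow> real^'r^'p) \<Rightarrow> real" where
  "H2_error t0 tf A B C Ar Br Cr =
     (H2_norm t0 tf (\<lambda>t \<tau>. impulse_response t0 tf A B C t \<tau>
                             - impulse_response t0 tf Ar Br Cr t \<tau>))\<^sup>2"

lemma H2_error_eq_integral:
  "H2_error t0 tf A B C Ar Br Cr =
     integral {t0..tf} (\<lambda>t. integral {t0..t} (\<lambda>\<tau>.
       (norm (impulse_response t0 tf A B C t \<tau> - impulse_response t0 tf Ar Br Cr t \<tau>))\<^sup>2))"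
proof -
  have nonneg: "0 \<le> integral S f" if "\<And>x. 0 \<le> f x" for S and f :: "real \<Rightarrow> real"
    using that by (cases "f integrable_on S") (auto simp: integral_nonneg not_integrable_integral)
  show ?thesis
    unfolding H2_error_def H2_norm_def by (intro real_sqrt_pow2 nonneg) simp
qed

definition gramian_Pr ::
  "real \<Rightarrow> real \<Rightarrow> (real \<Rightarrow> real^'r^'r) \<Rightarrow> (real \<Rightarrow> real^'m^'r) \<Rightarrow> real \<Rightarrow> real^'r^'r" where
  "gramian_Pr t0 tf Ar Br t =
     integral {t0..t} (\<lambda>\<tau>. transition_matrix t0 tf Ar t \<tau> ** Br \<tau> ** transpose (Br \<tau>)
                            ** transpose (transition_matrix t0 tf Ar t \<tau>))"

definition gramian_X ::
  "real \<Rightarrow> real \<Rightarrow> (real \<Rightarrow> real^'n^'n) \<Rightarrow> (real \<Rightarrow> real^'m^'n)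
    \<Rightarrow> (real \<Rightarrow> real^'r^'r) \<Rightarrow> (real \<Rightarrow> real^'m^'r) \<Rightarrow> real \<Rightarrow> real^'r^'n" where
  "gramian_X t0 tf A B Ar Br t =
     integral {t0..t} (\<lambda>\<tau>. transition_matrix t0 tf A t \<tau> ** B \<tau> ** transpose (Br \<tau>)
                            ** transpose (transition_matrix t0 tf Ar t \<tau>))"

definition gramian_Qr ::
  "real \<Rightarrow> real \<Rightarrow> (real \<Rightarrow> real^'r^'r) \<Rightarrow> (real \<Rightarrow> real^'r^'p) \<Rightarrow> real \<Rightarrow> real^'r^'r" where
  "gramian_Qr t0 tf Ar Cr t =
     integral {t..tf} (\<lambda>\<tau>. transpose (transition_matrix t0 tf Ar \<tau> t) ** transpose (Cr \<tau>)
                            ** Cr \<tau> ** transition_matrix t0 tf Ar \<tau> t)"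

definition gramian_Y ::
  "real \<Rightarrow> real \<Rightarrow> (real \<Rightarrow> real^'n^'n) \<Rightarrow> (real \<Rightarrow> real^'n^'p)
    \<Rightarrow> (real \<Rightarrow> real^'r^'r) \<Rightarrow> (real \<Rightarrow> real^'r^'p) \<Rightarrow> real \<Rightarrow> real^'r^'n" where
  "gramian_Y t0 tf A C Ar Cr t =
     integral {t..tf} (\<lambda>\<tau>. transpose (transition_matrix t0 tf A \<tau> t) ** transpose (C \<tau>)
                            ** Cr \<tau> ** transition_matrix t0 tf Ar \<tau> t)"

(* D is the functional derivative of F at f.  Integrability is required explicitly because
   the library integral of a non-integrable function is 0.  For a functional of several
   arguments, F is the partial functional with the other arguments held fixed. *)
definition has_functional_derivative ::
  "real \<Rightarrow> real \<Rightarrow> ((real \<Rightarrow> real^'b^'a) \<Rightarrow> real) \<Rightarrow> (real \<Rightarrow> real^'b^'a)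
    \<Rightarrow> (real \<Rightarrow> real^'b^'a) \<Rightarrow> bool" where
  "has_functional_derivative t0 tf F f D \<longleftrightarrow>
     (\<forall>\<Delta>\<in>cont_bdd t0 tf.
        (\<lambda>t. trace (transpose (D t) ** \<Delta> t)) integrable_on {t0..tf} \<and>
        ((\<lambda>\<epsilon>. (F (\<lambda>t. f t + \<epsilon> *\<^sub>R \<Delta> t) - F f) / \<epsilon>)
           \<longlongrightarrow> integral {t0..tf} (\<lambda>t. trace (transpose (D t) ** \<Delta> t))) (at 0))"

lemma trace_transpose_mult_eq_inner:
  fixes M N :: "real^'b^'a"
  shows "trace (transpose M ** N) = M \<bullet> N"
  unfolding trace_def transpose_def matrix_matrix_mult_def inner_vec_def
  by (simp, rule sum.swap)

lemma functional_derivative_unique: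
  fixes D E :: "real \<Rightarrow> real^'b^'a"
  assumes "t0 < tf"
    and D: "has_functional_derivative t0 tf F f D" and E: "has_functional_derivative t0 tf F f E"
    and cont: "continuous_on {t0..tf} D" "continuous_on {t0..tf} E"
    and t: "t \<in> {t0..tf}"
  shows "D t = E t"
proof -
  define \<Delta> where "\<Delta> = (\<lambda>t. D t - E t)"
  have c: "continuous_on {t0..tf} \<Delta>"
    unfolding \<Delta>_def by (intro continuous_intros cont)
  then have \<Delta>: "\<Delta> \<in> cont_bdd t0 tf"
    by (simp add: cont_bdd_def compact_imp_bounded compact_continuous_image)
  have i: "(\<lambda>t. D t \<bullet> \<Delta> t) integrable_on {t0..tf}" "(\<lambda>t. E t \<bullet> \<Delta> t) integrable_on {t0..tf}"
    using D E \<Delta> by (auto simp: has_functional_derivative_def trace_transpose_mult_eq_inner)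
  have "integral {t0..tf} (\<lambda>t. D t \<bullet> \<Delta> t) = integral {t0..tf} (\<lambda>t. E t \<bullet> \<Delta> t)"
    using D E \<Delta> unfolding has_functional_derivative_def trace_transpose_mult_eq_inner
    by (meson LIM_unique)
  then have "integral {t0..tf} (\<lambda>t. \<Delta> t \<bullet> \<Delta> t) = 0"
    using integral_diff[OF i] by (simp add: \<Delta>_def inner_diff_left)
  moreover have c2: "continuous_on {t0..tf} (\<lambda>t. \<Delta> t \<bullet> \<Delta> t)"
    by (intro continuous_intros c)
  ultimately have "\<Delta> t \<bullet> \<Delta> t = 0"
    using integral_eq_0_iff[OF c2 assms(1)] t by simp
  then show ?thesis by (simp add: \<Delta>_def)
qed

end

theory Submission imports Defs begin

text \<open>
  Write \<open>E\<close> for the difference of the two impulse responses. If the reduced impulse response moves by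
  \<open>\<epsilon> G + o(\<epsilon>)\<close> uniformly on the triangle \<open>t\<^sub>0 \<le> s \<le> t \<le> t\<^sub>f\<close>, then expanding the square gives
  \<open>-2 \<integral>\<integral> \<langle>E, G\<rangle>\<close> as the derivative of the squared error. For \<open>B\<^sub>r\<close> and \<open>C\<^sub>r\<close> the response
  is affine; for \<open>A\<^sub>r\<close>, variation of constants gives
  \<open>G(t,s) = \<integral>\<^bsub>[s,t]\<^esub> C\<^sub>r(t) \<phi>\<^sub>r(t,u) \<Delta>(u) \<phi>\<^sub>r(u,s) B\<^sub>r(s) du\<close>. Fubini on triangles brings the
  integration over the time of \<open>\<Delta>\<close> to the outside. By the cocycle property of the transition matrices,
  integrating out the input times produces \<open>X\<close> and \<open>P\<^sub>r\<close>, and integrating out the output times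
  produces \<open>Y\<close> and \<open>Q\<^sub>r\<close>.
\<close>

subsection \<open>Matrix calculus\<close>

lemma bounded_bilinear_matrix_mult:
  "bounded_bilinear (\<lambda>(M::real^'b^'a) (N::real^'c^'b). M ** N)"
proof -
  have "bilinear (\<lambda>(M::real^'b^'a) (N::real^'c^'b). M ** N)"
    unfolding bilinear_def
    by (intro conjI allI linearI)
       (simp_all add: matrix_matrix_mult_def vec_eq_iff algebra_simps sum.distrib sum_distrib_left)
  then show ?thesis by (simp add: bilinear_conv_bounded_bilinear)
qed

lemma bounded_linear_transpose: "bounded_linear (transpose :: real^'b^'a \<Rightarrow> real^'a^'b)"
  by (intro linear_conv_bounded_linear[THEN iffD1] linearI) (auto simp: transpose_def vec_eq_iff)

lemmas matrix_mult_continuous_on [continuous_intros] =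
  bounded_bilinear.continuous_on[OF bounded_bilinear_matrix_mult]
lemmas transpose_continuous_on [continuous_intros] =
  bounded_linear.continuous_on[OF bounded_linear_transpose]
lemmas matrix_mult_has_vector_derivative =
  bounded_bilinear.has_vector_derivative[OF bounded_bilinear_matrix_mult]
lemmas matrix_mult_add_left = bounded_bilinear.add_left[OF bounded_bilinear_matrix_mult]
lemmas matrix_mult_add_right = bounded_bilinear.add_right[OF bounded_bilinear_matrix_mult]
lemmas matrix_mult_diff_left = bounded_bilinear.diff_left[OF bounded_bilinear_matrix_mult]
lemmas matrix_mult_diff_right = bounded_bilinear.diff_right[OF bounded_bilinear_matrix_mult]
lemmas matrix_mult_scaleR_left = bounded_bilinear.scaleR_left[OF bounded_bilinear_matrix_mult]
lemmas matrix_mult_scaleR_right = bounded_bilinear.scaleR_right[OF bounded_bilinear_matrix_mult]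

lemma inner_matrix_mult_left:
  fixes M :: "real^'b^'a" and N :: "real^'c^'b" and P :: "real^'c^'a"
  shows "(M ** N) \<bullet> P = N \<bullet> (transpose M ** P)"
  by (metis trace_transpose_mult_eq_inner matrix_transpose_mul matrix_mul_assoc)

lemma inner_transpose:
  fixes M N :: "real^'b^'a"
  shows "transpose M \<bullet> transpose N = M \<bullet> N"
  unfolding inner_vec_def transpose_def by simp (rule sum.swap)

lemma inner_matrix_mult_right:
  fixes M :: "real^'b^'a" and N :: "real^'c^'b" and P :: "real^'c^'a"
  shows "(M ** N) \<bullet> P = M \<bullet> (P ** transpose N)"
proof -
  have "(M ** N) \<bullet> P = (transpose N ** transpose M) \<bullet> transpose P"
    by (simp add: inner_transpose flip: matrix_transpose_mul)
  also have "\<dots> = transpose M \<bullet> transpose (P ** transpose N)"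
    by (simp add: inner_matrix_mult_left matrix_transpose_mul)
  finally show ?thesis by (simp only: inner_transpose)
qed

lemma integral_bounded_linear_continuous:
  fixes f :: "real \<Rightarrow> 'a::euclidean_space" and h :: "'a \<Rightarrow> 'b::euclidean_space"
  assumes "bounded_linear h" "continuous_on {a..b} f"
  shows "integral {a..b} (\<lambda>x. h (f x)) = h (integral {a..b} f)"
  using integral_linear[OF integrable_continuous_real[OF assms(2)] assms(1)] by (simp add: o_def)

lemma integral_matrix_mult_left:
  fixes f :: "real \<Rightarrow> real^'c^'b" and M :: "real^'b^'a"
  assumes "continuous_on {a..b} f"
  shows "integral {a..b} (\<lambda>x. M ** f x) = M ** integral {a..b} f"
  using integral_bounded_linear_continuous
    [OF bounded_bilinear.bounded_linear_right[OF bounded_bilinear_matrix_mult] assms] .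

lemma integral_matrix_mult_right:
  fixes f :: "real \<Rightarrow> real^'b^'a" and M :: "real^'c^'b"
  assumes "continuous_on {a..b} f"
  shows "integral {a..b} (\<lambda>x. f x ** M) = integral {a..b} f ** M"
  using integral_bounded_linear_continuous
    [OF bounded_bilinear.bounded_linear_left[OF bounded_bilinear_matrix_mult] assms] .

subsection \<open>Transition matrices\<close>

lemma has_integral_power_fact:
  fixes t0 t K :: real
  assumes "t0 \<le> t"
  shows "((\<lambda>s. K * ((K * (s - t0)) ^ k / fact k)) has_integral (K * (t - t0)) ^ Suc k / fact (Suc k)) {t0..t}"
proof -
  have "((\<lambda>s. K * ((K * (s - t0)) ^ k / fact k)) has_integral
      ((K * (t - t0)) ^ Suc k / fact (Suc k) - (K * (t0 - t0)) ^ Suc k / fact (Suc k))) {t0..t}"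
  proof (rule fundamental_theorem_of_calculus[OF assms])
    fix x assume "x \<in> {t0..t}"
    have "((\<lambda>s. (K * (s - t0)) ^ Suc k / fact (Suc k)) has_real_derivative
        (1 + real k) * (K * (K * (x - t0)) ^ k) / fact (Suc k)) (at x within {t0..t})"
      by (intro DERIV_cdivide DERIV_power_Suc) (auto intro!: derivative_eq_intros)
    also have "(1 + real k) * (K * (K * (x - t0)) ^ k) / fact (Suc k) = K * ((K * (x - t0)) ^ k / fact k)"
      by (simp add: fact_Suc)
    finally show "((\<lambda>s. (K * (s - t0)) ^ Suc k / fact (Suc k)) has_vector_derivative
        K * ((K * (x - t0)) ^ k / fact k)) (at x within {t0..t})"
      by (simp add: has_real_derivative_iff_has_vector_derivative)
  qed
  then show ?thesis by simp
qed

text \<open>The Neumann series of Picard iterates; its terms are dominated by those of an exponential series.\<close>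

lemma linear_ode_exists:
  fixes L :: "real \<Rightarrow> 'a::euclidean_space \<Rightarrow>\<^sub>L 'a" and c :: 'a
  assumes cL: "continuous_on {t0..tf} L"
  obtains x where "x t0 = c"
    and "\<And>t. t \<in> {t0..tf} \<Longrightarrow> (x has_vector_derivative L t (x t)) (at t within {t0..tf})"
proof (cases "t0 \<le> tf")
  case False
  with that[of "\<lambda>_. c"] show ?thesis by simp
next
  case True
  obtain K where K: "K > 0" "\<And>s. s \<in> {t0..tf} \<Longrightarrow> norm (L s) \<le> K"
    using compact_imp_bounded[OF compact_continuous_image[OF cL compact_Icc]]
    by (auto simp: bounded_pos)
  define X where "X = rec_nat (\<lambda>t. c) (\<lambda>k y t. integral {t0..t} (\<lambda>s. L s (y s)))"
  have X0: "X 0 t = c" and XS: "X (Suc k) t = integral {t0..t} (\<lambda>s. L s (X k s))" for k t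
    by (simp_all add: X_def)
  have cLX: "continuous_on {t0..tf} (\<lambda>s. L s (y s))" if "continuous_on {t0..tf} y" for y
    by (intro continuous_intros cL that)
  have cX: "continuous_on {t0..tf} (X k)" for k
  proof (induction k)
    case 0
    have "X 0 = (\<lambda>_. c)" by (simp add: X_def)
    then show ?case by simp
  next
    case (Suc k)
    have "X (Suc k) = (\<lambda>t. integral {t0..t} (\<lambda>s. L s (X k s)))" by (simp add: X_def)
    then show ?case
      using indefinite_integral_continuous_1[OF integrable_continuous_real[OF cLX[OF Suc]]] by simp
  qed
  have bound: "norm (X k t) \<le> norm c * ((K * (t - t0)) ^ k / fact k)" if "t \<in> {t0..tf}" for k t
    using that
  proof (induction k arbitrary: t)
    case 0
    then show ?case by (simp add: X0)
  next
    case (Suc k)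
    have sub: "{t0..t} \<subseteq> {t0..tf}" using Suc.prems by auto
    have hi: "((\<lambda>s. norm c * (K * ((K * (s - t0)) ^ k / fact k))) has_integral
          norm c * ((K * (t - t0)) ^ Suc k / fact (Suc k))) {t0..t}"
      using has_integral_mult_right[OF has_integral_power_fact[of t0 t K k]] Suc.prems by simp
    have "norm (integral {t0..t} (\<lambda>s. L s (X k s))) \<le>
        integral {t0..t} (\<lambda>s. norm c * (K * ((K * (s - t0)) ^ k / fact k)))"
    proof (rule integral_norm_bound_integral)
      show "(\<lambda>s. L s (X k s)) integrable_on {t0..t}"
        using integrable_continuous_real[OF continuous_on_subset[OF cLX[OF cX] sub]] .
      show "(\<lambda>s. norm c * (K * ((K * (s - t0)) ^ k / fact k))) integrable_on {t0..t}"
        using hi by blast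
      fix s assume s: "s \<in> {t0..t}"
      then have s': "s \<in> {t0..tf}" using sub by auto
      have "norm (L s (X k s)) \<le> norm (L s) * norm (X k s)" by (rule norm_blinfun)
      also have "\<dots> \<le> K * (norm c * ((K * (s - t0)) ^ k / fact k))"
        using K s' Suc.IH[OF s'] by (intro mult_mono) auto
      finally show "norm (L s (X k s)) \<le> norm c * (K * ((K * (s - t0)) ^ k / fact k))"
        by (simp add: mult_ac)
    qed
    with hi show ?case by (simp only: XS integral_unique)
  qed
  define M where "M = (\<lambda>k. norm c * ((K * (tf - t0)) ^ k / fact k))"
  have sM: "summable M"
    unfolding M_def using summable_exp_generic[of "K * (tf - t0)"]
    by (intro summable_mult) (simp add: divide_inverse mult.commute)
  have boundM: "norm (X k t) \<le> M k" if "t \<in> {t0..tf}" for k t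
  proof -
    have "(K * (t - t0)) ^ k \<le> (K * (tf - t0)) ^ k"
      using that K by (intro power_mono) auto
    then have "norm c * ((K * (t - t0)) ^ k / fact k) \<le> M k"
      unfolding M_def by (intro mult_left_mono divide_right_mono) auto
    with bound[OF that] show ?thesis by (rule order_trans)
  qed
  define S where "S = (\<lambda>n t. \<Sum>k<n. X k t)"
  define x where "x = (\<lambda>t. \<Sum>k. X k t)"
  have ul: "uniform_limit {t0..tf} S x sequentially"
    unfolding S_def x_def by (rule Weierstrass_m_test[OF boundM sM])
  have cS: "continuous_on {t0..tf} (S n)" for n
    unfolding S_def by (intro continuous_intros cX[unfolded eta_contract_eq])
  have cx: "continuous_on {t0..tf} x"
    by (rule uniform_limit_theorem[OF _ ul]) (auto simp: cS)
  have ul2: "uniform_limit {t0..tf} (\<lambda>n s. L s (S n s)) (\<lambda>s. L s (x s)) sequentially"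
  proof (rule uniform_limitI)
    fix e :: real assume "0 < e"
    then have "\<forall>\<^sub>F n in sequentially. \<forall>s\<in>{t0..tf}. dist (S n s) (x s) < e / K"
      using uniform_limitD[OF ul] K by simp
    then show "\<forall>\<^sub>F n in sequentially. \<forall>s\<in>{t0..tf}. dist (L s (S n s)) (L s (x s)) < e"
    proof eventually_elim
      case (elim n)
      show ?case
      proof
        fix s assume s: "s \<in> {t0..tf}"
        have "dist (L s (S n s)) (L s (x s)) \<le> norm (L s) * dist (S n s) (x s)"
          using norm_blinfun[of "L s" "S n s - x s"] by (simp add: dist_norm blinfun.diff_right)
        also have "\<dots> \<le> K * dist (S n s) (x s)" using K s by (intro mult_right_mono) auto
        also have "\<dots> < e" using elim s K by (auto simp: field_simps)
        finally show "dist (L s (S n s)) (L s (x s)) < e" .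
      qed
    qed
  qed
  have eq: "x t = c + integral {t0..t} (\<lambda>s. L s (x s))" if t: "t \<in> {t0..tf}" for t
  proof -
    have sub: "{t0..t} \<subseteq> {t0..tf}" using t by auto
    have iX: "(\<lambda>s. L s (X k s)) integrable_on {t0..t}" for k
      using integrable_continuous_real[OF continuous_on_subset[OF cLX[OF cX] sub]] .
    obtain I J where IJ: "\<And>n. ((\<lambda>s. L s (S n s)) has_integral I n) {t0..t}"
      "((\<lambda>s. L s (x s)) has_integral J) {t0..t}" "I \<longlonglongrightarrow> J"
      by (rule uniform_limit_integral[OF uniform_limit_on_subset[OF ul2 sub]
        continuous_on_subset[OF cLX[OF cS] sub] sequentially_bot]) (rule that)
    have "S (Suc n) t = c + I n" for n
    proof -
      have "I n = integral {t0..t} (\<lambda>s. L s (S n s))"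
        using integral_unique[OF IJ(1)] by simp
      also have "\<dots> = integral {t0..t} (\<lambda>s. \<Sum>k<n. L s (X k s))"
        by (simp add: S_def blinfun.sum_right)
      also have "\<dots> = (\<Sum>k<n. X (Suc k) t)"
        by (subst integral_sum) (auto simp: XS iX)
      finally show ?thesis unfolding S_def by (simp add: sum.lessThan_Suc_shift X0 del: sum.lessThan_Suc)
    qed
    moreover have "(\<lambda>n. S (Suc n) t) \<longlonglongrightarrow> x t"
      using tendsto_uniform_limitI[OF ul t] by (rule LIMSEQ_Suc)
    moreover have "(\<lambda>n. c + I n) \<longlonglongrightarrow> c + J" by (intro tendsto_intros IJ)
    ultimately have "x t = c + J" using LIMSEQ_unique by fastforce
    then show ?thesis by (simp add: integral_unique[OF IJ(2)])
  qed
  show ?thesis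
  proof (rule that)
    show "x t0 = c" using eq[of t0] True by simp
    fix t assume t: "t \<in> {t0..tf}"
    have "((\<lambda>t. c + integral {t0..t} (\<lambda>s. L s (x s))) has_vector_derivative 0 + L t (x t))
        (at t within {t0..tf})"
      by (intro has_vector_derivative_add has_vector_derivative_const
          integral_has_vector_derivative cLX cx t)
    then show "(x has_vector_derivative L t (x t)) (at t within {t0..tf})"
      by (intro has_vector_derivative_transform[OF t eq]) simp_all
  qed
qed

lemma fundamental_matrix_exists:
  fixes A :: "real \<Rightarrow> real^'n^'n"
  assumes "continuous_on {t0..tf} A"
  obtains \<Phi> :: "real \<Rightarrow> real^'n^'n" where "\<Phi> t0 = mat 1"
    "\<And>t. t \<in> {t0..tf} \<Longrightarrow> (\<Phi> has_vector_derivative A t ** \<Phi> t) (at t within {t0..tf})"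
proof -
  define L :: "real \<Rightarrow> (real^'n^'n) \<Rightarrow>\<^sub>L (real^'n^'n)" where "L = (\<lambda>t. bounded_bilinear.prod_right (**) (A t))"
  have L: "L t M = A t ** M" for t and M :: "real^'n^'n"
    unfolding L_def by (simp add: bounded_bilinear.prod_right.rep_eq[OF bounded_bilinear_matrix_mult])
  have "continuous_on {t0..tf} L"
    unfolding L_def
    by (intro bounded_linear.continuous_on[OF
        bounded_bilinear.bounded_linear_prod_right[OF bounded_bilinear_matrix_mult]] assms)
  then show thesis using linear_ode_exists[of t0 tf L "mat 1"] that unfolding L by blast
qed

text \<open>The second factor solves the adjoint equation, which makes it the inverse of the first.\<close>

lemma transition_matrix_factorization:
  fixes A :: "real \<Rightarrow> real^'n^'n"
  assumes cA: "continuous_on {t0..tf} A"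
  obtains \<Phi> \<Psi> :: "real \<Rightarrow> real^'n^'n" where
    "\<forall>t\<in>{t0..tf}. (\<Phi> has_vector_derivative A t ** \<Phi> t) (at t within {t0..tf})"
    "\<forall>t\<in>{t0..tf}. (\<Psi> has_vector_derivative - (\<Psi> t ** A t)) (at t within {t0..tf})"
    "\<forall>t\<in>{t0..tf}. \<Psi> t ** \<Phi> t = mat 1 \<and> \<Phi> t ** \<Psi> t = mat 1"
    "\<forall>t\<in>{t0..tf}. \<forall>s\<in>{t0..tf}. transition_matrix t0 tf A t s = \<Phi> t ** \<Psi> s"
proof -
  obtain \<Phi> where P0: "\<Phi> t0 = mat 1"
    and P: "\<And>t. t \<in> {t0..tf} \<Longrightarrow> (\<Phi> has_vector_derivative A t ** \<Phi> t) (at t within {t0..tf})"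
    using fundamental_matrix_exists[OF cA] by blast
  have "continuous_on {t0..tf} (\<lambda>t. - transpose (A t))" by (intro continuous_intros cA)
  then obtain \<Theta> where T0: "\<Theta> t0 = mat 1"
    and T: "\<And>t. t \<in> {t0..tf} \<Longrightarrow>
      (\<Theta> has_vector_derivative - transpose (A t) ** \<Theta> t) (at t within {t0..tf})"
    using fundamental_matrix_exists by blast
  define \<Psi> where "\<Psi> = (\<lambda>t. transpose (\<Theta> t))"
  have S: "(\<Psi> has_vector_derivative - (\<Psi> t ** A t)) (at t within {t0..tf})" if "t \<in> {t0..tf}" for t
  proof -
    have "transpose (- transpose (A t) ** \<Theta> t) = - (\<Psi> t ** A t)"
      unfolding \<Psi>_def
      by (simp add: bounded_bilinear.minus_left[OF bounded_bilinear_matrix_mult]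
          linear_neg[OF bounded_linear.linear[OF bounded_linear_transpose]] matrix_transpose_mul)
    then show ?thesis
      using bounded_linear.has_vector_derivative[OF bounded_linear_transpose T[OF that]]
      unfolding \<Psi>_def by simp
  qed
  have const: "\<Psi> t ** X t = \<Psi> s ** X s"
    if X: "\<And>t. t \<in> {t0..tf} \<Longrightarrow> (X has_vector_derivative A t ** X t) (at t within {t0..tf})"
      and ts: "t \<in> {t0..tf}" "s \<in> {t0..tf}" for X :: "real \<Rightarrow> real^'n^'n" and t s
  proof -
    have "((\<lambda>t. \<Psi> t ** X t) has_vector_derivative 0) (at t within {t0..tf})" if "t \<in> {t0..tf}" for t
      using matrix_mult_has_vector_derivative[OF S[OF that] X[OF that]]
      by (simp add: bounded_bilinear.minus_left[OF bounded_bilinear_matrix_mult] matrix_mul_assoc)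
    from has_vector_derivative_zero_constant[OF convex_real_interval(5) this]
    obtain c where "\<And>t. t \<in> {t0..tf} \<Longrightarrow> \<Psi> t ** X t = c" by metis
    then show ?thesis using ts by metis
  qed
  have SP: "\<Psi> t ** \<Phi> t = mat 1" if "t \<in> {t0..tf}" for t
    using const[OF P that, of t0] that by (simp add: P0 T0 \<Psi>_def)
  then have PS: "\<Phi> t ** \<Psi> t = mat 1" if "t \<in> {t0..tf}" for t
    using that matrix_left_right_inverse by blast
  have "is_transition_matrix t0 tf A (\<lambda>t s. \<Phi> t ** \<Psi> s)"
    unfolding is_transition_matrix_def
    using PS bounded_bilinear.bounded_linear_left[OF bounded_bilinear_matrix_mult]
    by (auto simp: matrix_mul_assoc
        intro!: bounded_linear.has_vector_derivative[OF _ P, where f = "\<lambda>M. M ** _", THEN has_vector_derivative_eq_rhs])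
  then have tm: "is_transition_matrix t0 tf A (transition_matrix t0 tf A)"
    unfolding transition_matrix_def by (rule someI[where P = "is_transition_matrix t0 tf A"])
  have "transition_matrix t0 tf A t s = \<Phi> t ** \<Psi> s" if ts: "t \<in> {t0..tf}" "s \<in> {t0..tf}" for t s
  proof -
    have "\<Psi> t ** transition_matrix t0 tf A t s = \<Psi> s ** transition_matrix t0 tf A s s"
      by (rule const[OF _ ts]) (use tm ts(2) in \<open>auto simp: is_transition_matrix_def\<close>)
    also have "\<dots> = \<Psi> s" using tm ts(2) by (simp add: is_transition_matrix_def)
    finally have "\<Phi> t ** (\<Psi> t ** transition_matrix t0 tf A t s) = \<Phi> t ** \<Psi> s" by simp
    then show ?thesis by (simp add: matrix_mul_assoc PS[OF ts(1)])
  qed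
  with P S SP PS show thesis by (intro that[of \<Phi> \<Psi>]) auto
qed

lemma
  fixes A :: "real \<Rightarrow> real^'n^'n"
  assumes cA: "continuous_on {t0..tf} A"
  shows transition_matrix_continuous:
      "continuous_on ({t0..tf} \<times> {t0..tf}) (\<lambda>(t, s). transition_matrix t0 tf A t s)"
    and transition_matrix_cocycle:
      "\<lbrakk>t \<in> {t0..tf}; s \<in> {t0..tf}; u \<in> {t0..tf}\<rbrakk> \<Longrightarrow>
        transition_matrix t0 tf A t s ** transition_matrix t0 tf A s u = transition_matrix t0 tf A t u"
    and transition_matrix_same: "t \<in> {t0..tf} \<Longrightarrow> transition_matrix t0 tf A t t = mat 1"
proof -
  obtain \<Phi> \<Psi> :: "real \<Rightarrow> real^'n^'n" where P: "\<forall>t\<in>{t0..tf}. (\<Phi> has_vector_derivative A t ** \<Phi> t) (at t within {t0..tf})"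
    and S: "\<forall>t\<in>{t0..tf}. (\<Psi> has_vector_derivative - (\<Psi> t ** A t)) (at t within {t0..tf})"
    and inv: "\<forall>t\<in>{t0..tf}. \<Psi> t ** \<Phi> t = mat 1 \<and> \<Phi> t ** \<Psi> t = mat 1"
    and eq: "\<forall>t\<in>{t0..tf}. \<forall>s\<in>{t0..tf}. transition_matrix t0 tf A t s = \<Phi> t ** \<Psi> s"
    by (rule transition_matrix_factorization[OF cA])
  have c: "continuous_on {t0..tf} \<Phi>" "continuous_on {t0..tf} \<Psi>"
    using P S by (auto simp: continuous_on_eq_continuous_within intro: has_vector_derivative_continuous)
  have "continuous_on ({t0..tf} \<times> {t0..tf}) (\<lambda>x. \<Phi> (fst x) ** \<Psi> (snd x))"
    by (intro continuous_intros continuous_on_compose2[OF c(1)] continuous_on_compose2[OF c(2)]) auto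
  then show "continuous_on ({t0..tf} \<times> {t0..tf}) (\<lambda>(t, s). transition_matrix t0 tf A t s)"
    by (rule continuous_on_eq) (auto simp: eq)
  show "transition_matrix t0 tf A t t = mat 1" if "t \<in> {t0..tf}"
    using eq inv that by simp
  show "transition_matrix t0 tf A t s ** transition_matrix t0 tf A s u = transition_matrix t0 tf A t u"
    if "t \<in> {t0..tf}" "s \<in> {t0..tf}" "u \<in> {t0..tf}"
  proof -
    have "\<Phi> t ** \<Psi> s ** (\<Phi> s ** \<Psi> u) = \<Phi> t ** (\<Psi> s ** \<Phi> s) ** \<Psi> u" by (simp add: matrix_mul_assoc)
    then show ?thesis using that by (simp add: eq inv)
  qed
qed

lemma transition_matrix_continuous_compose [continuous_intros]:
  fixes A :: "real \<Rightarrow> real^'n^'n"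
  assumes "continuous_on {t0..tf} A" "continuous_on S f" "continuous_on S g"
    and "\<And>x. x \<in> S \<Longrightarrow> f x \<in> {t0..tf}" "\<And>x. x \<in> S \<Longrightarrow> g x \<in> {t0..tf}"
  shows "continuous_on S (\<lambda>x. transition_matrix t0 tf A (f x) (g x))"
proof -
  have "continuous_on S (\<lambda>x. (\<lambda>(t, s). transition_matrix t0 tf A t s) (f x, g x))"
    by (rule continuous_on_compose2[OF transition_matrix_continuous[OF assms(1)]])
       (use assms in \<open>auto intro!: continuous_intros\<close>)
  then show ?thesis by simp
qed

text \<open>Variation of constants: integrate the derivative of \<open>u \<mapsto> \<phi>(t,u) \<phi>'(u,s)\<close> over \<open>[s,t]\<close>.\<close>

lemma transition_matrix_difference:
  fixes A A' :: "real \<Rightarrow> real^'n^'n"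
  assumes cA: "continuous_on {t0..tf} A" and cA': "continuous_on {t0..tf} A'"
    and ts: "t0 \<le> s" "s \<le> t" "t \<le> tf"
  shows "transition_matrix t0 tf A' t s - transition_matrix t0 tf A t s =
    integral {s..t} (\<lambda>u. transition_matrix t0 tf A t u ** (A' u - A u) ** transition_matrix t0 tf A' u s)"
proof -
  obtain \<Phi> \<Psi> :: "real \<Rightarrow> real^'n^'n" where P: "\<forall>t\<in>{t0..tf}. (\<Phi> has_vector_derivative A t ** \<Phi> t) (at t within {t0..tf})"
    and S: "\<forall>t\<in>{t0..tf}. (\<Psi> has_vector_derivative - (\<Psi> t ** A t)) (at t within {t0..tf})"
    and inv: "\<forall>t\<in>{t0..tf}. \<Psi> t ** \<Phi> t = mat 1 \<and> \<Phi> t ** \<Psi> t = mat 1"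
    and eq: "\<forall>t\<in>{t0..tf}. \<forall>s\<in>{t0..tf}. transition_matrix t0 tf A t s = \<Phi> t ** \<Psi> s"
    by (rule transition_matrix_factorization[OF cA])
  obtain \<Phi>' \<Psi>' :: "real \<Rightarrow> real^'n^'n" where P': "\<forall>t\<in>{t0..tf}. (\<Phi>' has_vector_derivative A' t ** \<Phi>' t) (at t within {t0..tf})"
    and S': "\<forall>t\<in>{t0..tf}. (\<Psi>' has_vector_derivative - (\<Psi>' t ** A' t)) (at t within {t0..tf})"
    and inv': "\<forall>t\<in>{t0..tf}. \<Psi>' t ** \<Phi>' t = mat 1 \<and> \<Phi>' t ** \<Psi>' t = mat 1"
    and eq': "\<forall>t\<in>{t0..tf}. \<forall>s\<in>{t0..tf}. transition_matrix t0 tf A' t s = \<Phi>' t ** \<Psi>' s"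
    by (rule transition_matrix_factorization[OF cA'])
  have mem: "t \<in> {t0..tf}" "s \<in> {t0..tf}" using ts by auto
  define F where "F = (\<lambda>u. \<Phi> t ** (\<Psi> u ** \<Phi>' u) ** \<Psi>' s)"
  have bl: "bounded_linear (\<lambda>M::real^'n^'n. \<Phi> t ** M ** \<Psi>' s)"
    using bounded_linear_compose[OF
        bounded_bilinear.bounded_linear_left[OF bounded_bilinear_matrix_mult]
        bounded_bilinear.bounded_linear_right[OF bounded_bilinear_matrix_mult]] .
  have "((\<lambda>u. transition_matrix t0 tf A t u ** (A' u - A u) ** transition_matrix t0 tf A' u s)
      has_integral F t - F s) {s..t}"
  proof (rule fundamental_theorem_of_calculus[OF ts(2)])
    fix u assume u: "u \<in> {s..t}"
    then have u': "u \<in> {t0..tf}" using ts by auto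
    have sub: "{s..t} \<subseteq> {t0..tf}" using ts by auto
    have "((\<lambda>u. \<Psi> u ** \<Phi>' u) has_vector_derivative \<Psi> u ** (A' u - A u) ** \<Phi>' u) (at u within {t0..tf})"
      using matrix_mult_has_vector_derivative[OF bspec[OF S u'] bspec[OF P' u']]
      by (simp add: bounded_bilinear.minus_left[OF bounded_bilinear_matrix_mult]
          matrix_mult_diff_left matrix_mult_diff_right matrix_mul_assoc)
    from has_vector_derivative_within_subset[OF bounded_linear.has_vector_derivative[OF bl this] sub]
    show "(F has_vector_derivative
        transition_matrix t0 tf A t u ** (A' u - A u) ** transition_matrix t0 tf A' u s) (at u within {s..t})"
      unfolding F_def by (simp add: eq eq' mem u' matrix_mul_assoc del: atLeastAtMost_iff)
  qed
  moreover have "F t = transition_matrix t0 tf A' t s"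
    unfolding F_def by (simp add: eq' mem matrix_mul_assoc inv del: atLeastAtMost_iff)
  moreover have "F s = transition_matrix t0 tf A t s"
  proof -
    have "F s = \<Phi> t ** \<Psi> s ** (\<Phi>' s ** \<Psi>' s)" unfolding F_def by (simp add: matrix_mul_assoc)
    then show ?thesis by (simp add: eq mem inv' del: atLeastAtMost_iff)
  qed
  ultimately show ?thesis by (simp add: integral_unique)
qed

text \<open>A bound on the perturbed transition matrices
  that is uniform in \<open>\<epsilon>\<close> comes from their variation of constants formula at a point of the triangle
  where their norm is maximal; no Gronwall inequality is needed.\<close>

lemma transition_matrix_first_variation:
  fixes A \<Delta> :: "real \<Rightarrow> real^'n^'n"
  assumes t0f: "t0 \<le> tf" and cA: "continuous_on {t0..tf} A" and cD: "continuous_on {t0..tf} \<Delta>"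
  shows "uniform_limit {(t, s). t0 \<le> s \<and> s \<le> t \<and> t \<le> tf}
    (\<lambda>\<epsilon> (t, s). (1 / \<epsilon>) *\<^sub>R
       (transition_matrix t0 tf (\<lambda>t. A t + \<epsilon> *\<^sub>R \<Delta> t) t s - transition_matrix t0 tf A t s))
    (\<lambda>(t, s). integral {s..t} (\<lambda>u. transition_matrix t0 tf A t u ** \<Delta> u ** transition_matrix t0 tf A u s))
    (at 0)"
proof -
  let ?T = "{(t, s). t0 \<le> s \<and> s \<le> t \<and> t \<le> tf}"
  let ?p = "transition_matrix t0 tf A"
  define q where "q = (\<lambda>\<epsilon>. transition_matrix t0 tf (\<lambda>t. A t + \<epsilon> *\<^sub>R \<Delta> t))"
  have cAe: "continuous_on {t0..tf} (\<lambda>t. A t + \<epsilon> *\<^sub>R \<Delta> t)" for \<epsilon>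
    by (intro continuous_intros cA cD)
  have cT: "compact ?T"
  proof -
    have "?T = ({t0..tf} \<times> {t0..tf}) \<inter> {x. snd x \<le> fst x}" by auto
    moreover have "closed {x::real \<times> real. snd x \<le> fst x}"
      by (intro closed_Collect_le continuous_intros)
    ultimately show ?thesis
      using compact_Int_closed[OF compact_Times[OF compact_Icc compact_Icc]] by metis
  qed
  obtain c where c: "c > 0" "\<And>(M::real^'n^'n) (N::real^'n^'n). norm (M ** N) \<le> norm M * norm N * c"
    using bounded_bilinear.pos_bounded[OF bounded_bilinear_matrix_mult] by blast
  obtain M where M: "M > 0" "\<And>t s. t \<in> {t0..tf} \<Longrightarrow> s \<in> {t0..tf} \<Longrightarrow> norm (?p t s) \<le> M"
    using compact_imp_bounded[OF compact_continuous_image[OF transition_matrix_continuous[OF cA]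
          compact_Times[OF compact_Icc compact_Icc]]]
    by (fastforce simp: bounded_pos)
  obtain D where D: "D > 0" "\<And>t. t \<in> {t0..tf} \<Longrightarrow> norm (\<Delta> t) \<le> D"
    using compact_imp_bounded[OF compact_continuous_image[OF cD compact_Icc]]
    by (auto simp: bounded_pos)
  define \<kappa> where "\<kappa> = M * D * c * c * (tf - t0)"
  have \<kappa>: "\<kappa> \<ge> 0" using M D c t0f by (auto simp: \<kappa>_def)
  have bound: "norm (integral {s..t} (\<lambda>u. ?p t u ** \<Delta> u ** Z u)) \<le> \<kappa> * z"
    if ts: "t0 \<le> s" "s \<le> t" "t \<le> tf" and cZ: "continuous_on {s..t} Z"
      and z: "\<And>u. u \<in> {s..t} \<Longrightarrow> norm (Z u) \<le> z" for s t z and Z :: "real \<Rightarrow> real^'n^'n"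
  proof -
    have z0: "0 \<le> z" using order_trans[OF norm_ge_zero z[of s]] ts by simp
    have "norm (integral {s..t} (\<lambda>u. ?p t u ** \<Delta> u ** Z u)) \<le> integral {s..t} (\<lambda>_. M * D * c * z * c)"
    proof (rule integral_norm_bound_integral)
      show "(\<lambda>u. ?p t u ** \<Delta> u ** Z u) integrable_on {s..t}"
        using ts by (intro integrable_continuous_real continuous_intros cA cZ continuous_on_subset[OF cD]) auto
      fix u assume u: "u \<in> {s..t}"
      have "norm (?p t u ** \<Delta> u ** Z u) \<le> norm (?p t u ** \<Delta> u) * norm (Z u) * c" by (rule c(2))
      also have "\<dots> \<le> (norm (?p t u) * norm (\<Delta> u) * c) * norm (Z u) * c"
        using c by (intro mult_right_mono c(2)) auto
      also have "\<dots> \<le> (M * D * c) * z * c"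
        using u ts c D M z[OF u] by (intro mult_right_mono mult_mono) auto
      finally show "norm (?p t u ** \<Delta> u ** Z u) \<le> M * D * c * z * c" .
    qed (rule integrable_const_ivl)
    also have "\<dots> = M * D * c * z * c * (t - s)" using ts by simp
    also have "\<dots> \<le> M * D * c * z * c * (tf - t0)"
      using ts M D c z0 by (intro mult_left_mono) auto
    finally show ?thesis by (simp add: \<kappa>_def mult_ac)
  qed
  have cq: "continuous_on {s..t} (\<lambda>u. q \<epsilon> u s)" if "t0 \<le> s" "s \<le> t" "t \<le> tf" for s t \<epsilon>
    unfolding q_def using that by (intro continuous_intros cA cD) auto
  have cp: "continuous_on {s..t} (\<lambda>u. ?p u s)" if "t0 \<le> s" "s \<le> t" "t \<le> tf" for s t
    using that by (intro continuous_intros cA) auto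
  have diff: "q \<epsilon> t s - ?p t s = \<epsilon> *\<^sub>R integral {s..t} (\<lambda>u. ?p t u ** \<Delta> u ** q \<epsilon> u s)"
    if "t0 \<le> s" "s \<le> t" "t \<le> tf" for s t \<epsilon>
    using transition_matrix_difference[OF cA cAe that, of \<epsilon>]
    by (simp add: q_def matrix_mult_scaleR_left matrix_mult_scaleR_right)
  have close: "norm (q \<epsilon> t s - ?p t s) \<le> \<bar>\<epsilon>\<bar> * (\<kappa> * (2 * M))"
    if ts: "t0 \<le> s" "s \<le> t" "t \<le> tf" and \<epsilon>: "\<bar>\<epsilon>\<bar> * \<kappa> \<le> 1 / 2" for s t \<epsilon>
  proof -
    have "continuous_on ?T (\<lambda>x. norm (q \<epsilon> (fst x) (snd x)))"
      unfolding q_def by (intro continuous_intros cA cD) auto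
    moreover have "?T \<noteq> {}" using t0f by auto
    ultimately obtain t' s' where t's': "t0 \<le> s'" "s' \<le> t'" "t' \<le> tf"
      and max: "\<And>t s. t0 \<le> s \<Longrightarrow> s \<le> t \<Longrightarrow> t \<le> tf \<Longrightarrow> norm (q \<epsilon> t s) \<le> norm (q \<epsilon> t' s')"
      using continuous_attains_sup[OF cT, of "\<lambda>x. norm (q \<epsilon> (fst x) (snd x))"] by auto
    let ?m = "norm (q \<epsilon> t' s')"
    have le: "norm (q \<epsilon> t s - ?p t s) \<le> \<bar>\<epsilon>\<bar> * (\<kappa> * ?m)" if ts: "t0 \<le> s" "s \<le> t" "t \<le> tf" for t s
      unfolding diff[OF ts] norm_scaleR
      using ts by (intro mult_left_mono bound cq max) auto
    have "?m \<le> norm (?p t' s') + norm (q \<epsilon> t' s' - ?p t' s')"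
      by (metis add.commute norm_triangle_sub)
    also have "\<dots> \<le> M + (\<bar>\<epsilon>\<bar> * \<kappa>) * ?m"
      using M(2)[of t' s'] le[OF t's'] t's' by (simp add: mult_ac)
    also have "\<dots> \<le> M + 1 / 2 * ?m" using \<epsilon> by (intro add_left_mono mult_right_mono) auto
    finally have "?m \<le> 2 * M" by simp
    then have "\<bar>\<epsilon>\<bar> * (\<kappa> * ?m) \<le> \<bar>\<epsilon>\<bar> * (\<kappa> * (2 * M))" using \<kappa> by (intro mult_left_mono) auto
    with le[OF ts] show ?thesis by linarith
  qed
  show ?thesis
  proof (rule uniform_limitI)
    fix e :: real assume e: "e > 0"
    define K where "K = \<kappa> * (\<kappa> * (2 * M))"
    have small: "\<forall>\<^sub>F \<epsilon> in at 0. \<bar>\<epsilon>\<bar> * k < x" if "0 < x" for k x :: real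
    proof (rule order_tendstoD(2)[OF _ that])
      have "((\<lambda>\<epsilon>::real. \<bar>\<epsilon>\<bar> * k) \<longlongrightarrow> \<bar>0\<bar> * k) (at 0)" by (intro tendsto_intros)
      then show "((\<lambda>\<epsilon>::real. \<bar>\<epsilon>\<bar> * k) \<longlongrightarrow> 0) (at 0)" by simp
    qed
    have "\<forall>\<^sub>F \<epsilon> in at (0::real). \<bar>\<epsilon>\<bar> * \<kappa> < 1 / 2" "\<forall>\<^sub>F \<epsilon> in at (0::real). \<bar>\<epsilon>\<bar> * K < e"
      using e by (intro small; simp)+
    moreover have "\<forall>\<^sub>F \<epsilon> in at (0::real). \<epsilon> \<noteq> 0" by (rule eventually_neq_at_within)
    ultimately show "\<forall>\<^sub>F \<epsilon> in at 0. \<forall>x\<in>?T. dist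
        (case x of (t, s) \<Rightarrow> (1 / \<epsilon>) *\<^sub>R
          (transition_matrix t0 tf (\<lambda>t. A t + \<epsilon> *\<^sub>R \<Delta> t) t s - ?p t s))
        (case x of (t, s) \<Rightarrow> integral {s..t} (\<lambda>u. ?p t u ** \<Delta> u ** ?p u s)) < e"
    proof eventually_elim
      case (elim \<epsilon>)
      have "norm ((1 / \<epsilon>) *\<^sub>R (q \<epsilon> t s - ?p t s) - integral {s..t} (\<lambda>u. ?p t u ** \<Delta> u ** ?p u s)) < e"
        if ts: "t0 \<le> s" "s \<le> t" "t \<le> tf" for t s
      proof -
        have int: "(\<lambda>u. ?p t u ** \<Delta> u ** Z u) integrable_on {s..t}"
          if "continuous_on {s..t} Z" for Z :: "real \<Rightarrow> real^'n^'n"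
          using ts by (intro integrable_continuous_real continuous_intros cA that
              continuous_on_subset[OF cD]) auto
        have "(1 / \<epsilon>) *\<^sub>R (q \<epsilon> t s - ?p t s) - integral {s..t} (\<lambda>u. ?p t u ** \<Delta> u ** ?p u s) =
            integral {s..t} (\<lambda>u. ?p t u ** \<Delta> u ** q \<epsilon> u s) - integral {s..t} (\<lambda>u. ?p t u ** \<Delta> u ** ?p u s)"
          unfolding diff[OF ts] using elim(3) by simp
        also have "\<dots> = integral {s..t} (\<lambda>u. ?p t u ** \<Delta> u ** (q \<epsilon> u s - ?p u s))"
          unfolding matrix_mult_diff_right
          by (rule Henstock_Kurzweil_Integration.integral_diff[symmetric, OF int[OF cq[OF ts]] int[OF cp[OF ts]]])
        also have "norm \<dots> \<le> \<kappa> * (\<bar>\<epsilon>\<bar> * (\<kappa> * (2 * M)))"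
        proof (rule bound[OF ts])
          show "continuous_on {s..t} (\<lambda>u. q \<epsilon> u s - ?p u s)"
            by (intro continuous_on_diff cq cp ts)
          show "norm (q \<epsilon> u s - ?p u s) \<le> \<bar>\<epsilon>\<bar> * (\<kappa> * (2 * M))" if "u \<in> {s..t}" for u
            using that ts elim(1) by (intro close) auto
        qed
        also have "\<dots> = \<bar>\<epsilon>\<bar> * K" by (simp add: K_def mult_ac)
        finally show ?thesis using elim(2) by linarith
      qed
      then show ?case by (auto simp: dist_norm q_def)
    qed
  qed
qed

subsection \<open>Integrals over triangles\<close>

lemma continuous_on_indefinite_integral_param:
  fixes f :: "real \<Rightarrow> real \<Rightarrow> 'a::banach"
  assumes f: "continuous_on ({a..b} \<times> {a..b}) (\<lambda>(t, s). f t s)"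
  shows "continuous_on {a..b} (\<lambda>t. integral {a..t} (f t))"
proof -
  have eq: "integral {a..t} (f t) = (t - a) *\<^sub>R integral (cbox 0 1) (\<lambda>u. f t ((t - a) * u + a))"
    if t: "t \<in> {a..b}" for t
  proof (cases "t = a")
    case False
    then have m: "t - a > 0" using t by simp
    have "continuous_on {a..t} (\<lambda>s. f t s)"
      by (rule continuous_on_compose2[OF f, where f = "Pair t", simplified]) (use t in \<open>auto intro!: continuous_intros\<close>)
    then have "(f t has_integral integral {a..t} (f t)) (cbox a t)"
      by (simp add: integrable_continuous_real integrable_integral)
    from integral_unique[OF has_integral_affinity'[OF this m, of a]] m
    show ?thesis by simp
  qed simp
  have "continuous_on ({a..b} \<times> cbox 0 1) (\<lambda>(t, u). f t ((t - a) * u + a))"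
  proof -
    have "(t - a) * u + a \<in> {a..b}" if "t \<in> {a..b}" "u \<in> {0..1}" for t u
      using that mult_left_le[of u "t - a"] by auto
    then show ?thesis
      unfolding case_prod_unfold
      by (intro continuous_on_compose2[OF f[unfolded case_prod_unfold],
            of _ "\<lambda>x. (fst x, (fst x - a) * snd x + a)", simplified] continuous_intros) auto
  qed
  then have "continuous_on {a..b} (\<lambda>t. (t - a) *\<^sub>R integral (cbox 0 1) (\<lambda>u. f t ((t - a) * u + a)))"
    by (intro continuous_intros integral_continuous_on_param)
  then show ?thesis by (rule continuous_on_eq) (simp only: eq)
qed

lemma continuous_on_slice:
  assumes "continuous_on (S \<times> T) (\<lambda>(t, s). f t s)" "t \<in> S"
  shows "continuous_on T (f t)"
proof -
  have "continuous_on T (\<lambda>s. (\<lambda>(t, s). f t s) (t, s))"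
    by (rule continuous_on_compose2[OF assms(1)]) (use assms(2) in \<open>auto intro!: continuous_intros\<close>)
  then show ?thesis by (simp add: eta_contract_eq)
qed

lemma triangle_Fubini:
  fixes f :: "real \<Rightarrow> real \<Rightarrow> 'a::euclidean_space"
  assumes f: "continuous_on ({a..b} \<times> {a..b}) (\<lambda>(t, s). f t s)"
  shows "integral {a..b} (\<lambda>t. integral {a..t} (f t)) = integral {a..b} (\<lambda>s. integral {s..b} (\<lambda>t. f t s))"
proof -
  define T where "T = {x \<in> {a..b} \<times> {a..b}. snd x \<le> fst x}"
  define g where "g = (\<lambda>t s. indicator T (t, s) *\<^sub>R f t s)"
  have "closed {x::real \<times> real. snd x \<le> fst x}"
    by (intro closed_Collect_le continuous_intros)
  then have "compact T"
    using compact_Int_closed[OF compact_Times[OF compact_Icc compact_Icc]]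
    unfolding T_def Collect_conj_eq by simp
  moreover have "continuous_on T (\<lambda>(t, s). f t s)"
    by (rule continuous_on_subset[OF f]) (auto simp: T_def)
  ultimately have "integrable lborel (\<lambda>x. indicator T x *\<^sub>R (case x of (t, s) \<Rightarrow> f t s))"
    by (rule borel_integrable_compact)
  then have int: "integrable (lborel \<Otimes>\<^sub>M lborel) (case_prod g)"
    by (simp add: lborel_prod g_def case_prod_unfold)
  have inner1: "(LINT s|lborel. g t s) = indicator {a..b} t *\<^sub>R integral {a..t} (f t)" for t
  proof (cases "t \<in> {a..b}")
    case True
    have "continuous_on {a..t} (f t)"
      by (rule continuous_on_subset[OF continuous_on_slice[OF f True]]) (use True in auto)
    then have "set_integrable lborel {a..t} (f t)" by (rule borel_integrable_atLeastAtMost')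
    from set_borel_integral_eq_integral(2)[OF this] show ?thesis
      using True by (auto simp: set_lebesgue_integral_def g_def T_def intro!: Bochner_Integration.integral_cong
         elim!: back_subst[where P="\<lambda>x. x = _"] split: split_indicator)
  next
    case False
    then have "g t = (\<lambda>s. 0)" by (auto simp: g_def T_def)
    with False show ?thesis by simp
  qed
  have f': "continuous_on ({a..b} \<times> {a..b}) (\<lambda>(s, t). f t s)"
    using continuous_on_compose2[OF f continuous_on_swap[of "{a..b} \<times> {a..b}"]]
    by (simp add: case_prod_unfold product_swap)
  have inner2: "(LINT t|lborel. g t s) = indicator {a..b} s *\<^sub>R integral {s..b} (\<lambda>t. f t s)" for s
  proof (cases "s \<in> {a..b}")
    case True
    have "continuous_on {s..b} (\<lambda>t. f t s)"
      by (rule continuous_on_subset[OF continuous_on_slice[OF f' True]]) (use True in auto)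
    then have "set_integrable lborel {s..b} (\<lambda>t. f t s)" by (rule borel_integrable_atLeastAtMost')
    from set_borel_integral_eq_integral(2)[OF this] show ?thesis
      using True by (auto simp: set_lebesgue_integral_def g_def T_def intro!: Bochner_Integration.integral_cong
         elim!: back_subst[where P="\<lambda>x. x = _"] split: split_indicator)
  next
    case False
    then have "(\<lambda>t. g t s) = (\<lambda>t. 0)" by (auto simp: g_def T_def)
    with False show ?thesis by simp
  qed
  have si1: "set_integrable lborel {a..b} (\<lambda>t. integral {a..t} (f t))"
    using lborel_pair.integrable_fst[OF int] by (simp add: inner1 set_integrable_def)
  have si2: "set_integrable lborel {a..b} (\<lambda>s. integral {s..b} (\<lambda>t. f t s))"
    using lborel_pair.integrable_snd[OF int] by (simp add: inner2 set_integrable_def)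
  have "(LINT s|lborel. LINT t|lborel. g t s) = (LINT t|lborel. LINT s|lborel. g t s)"
    by (rule lborel_pair.Fubini_integral[OF int])
  then show ?thesis
    using set_borel_integral_eq_integral(2)[OF si1] set_borel_integral_eq_integral(2)[OF si2]
    by (simp add: inner1 inner2 set_lebesgue_integral_def)
qed

lemma continuous_on_upper_integral_param:
  fixes f :: "real \<Rightarrow> real \<Rightarrow> 'a::banach"
  assumes f: "continuous_on ({a..b} \<times> {a..b}) (\<lambda>(t, s). f t s)"
  shows "continuous_on {a..b} (\<lambda>t. integral {t..b} (\<lambda>s. f t s))"
proof -
  have "integral {t..b} (f t) = integral {a..b} (f t) - integral {a..t} (f t)" if "t \<in> {a..b}" for t
    using Henstock_Kurzweil_Integration.integral_combine[of a t b "f t"] that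
      integrable_continuous_real[OF continuous_on_slice[OF f that]]
    by (simp add: algebra_simps)
  moreover have "continuous_on {a..b} (\<lambda>t. integral (cbox a b) (f t))"
    by (rule integral_continuous_on_param) (simp add: f)
  ultimately show ?thesis
    using continuous_on_indefinite_integral_param[OF f]
    by (subst continuous_on_cong[OF refl, of _ _ "\<lambda>t. integral {a..b} (f t) - integral {a..t} (f t)"])
       (auto intro!: continuous_intros)
qed

definition triangle_integral :: "real \<Rightarrow> real \<Rightarrow> (real \<Rightarrow> real \<Rightarrow> real) \<Rightarrow> real" where
  "triangle_integral a b f = integral {a..b} (\<lambda>t. integral {a..t} (f t))"

context
  fixes a b :: real and f :: "real \<Rightarrow> real \<Rightarrow> real"
  assumes f: "continuous_on ({a..b} \<times> {a..b}) (\<lambda>(t, s). f t s)"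
begin

lemma integrable_on_triangle_slice:
  assumes "t \<in> {a..b}"
  shows "f t integrable_on {a..t}"
  by (rule integrable_continuous_real, rule continuous_on_subset[OF continuous_on_slice[OF f assms]])
     (use assms in auto)

lemma integrable_on_triangle: "(\<lambda>t. integral {a..t} (f t)) integrable_on {a..b}"
  by (rule integrable_continuous_real[OF continuous_on_indefinite_integral_param[OF f]])

lemma triangle_integral_cmult: "triangle_integral a b (\<lambda>t s. c * f t s) = c * triangle_integral a b f"
  unfolding triangle_integral_def by simp

lemma abs_triangle_integral_le:
  assumes "a \<le> b" and bd: "\<And>t s. a \<le> s \<Longrightarrow> s \<le> t \<Longrightarrow> t \<le> b \<Longrightarrow> \<bar>f t s\<bar> \<le> M"
  shows "\<bar>triangle_integral a b f\<bar> \<le> M * (b - a)\<^sup>2"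
proof -
  have "\<bar>f a a\<bar> \<le> M" using assms by blast
  then have M: "0 \<le> M" by linarith
  have "norm (integral {a..t} (f t)) \<le> M * (b - a)" if t: "t \<in> {a..b}" for t
  proof -
    have "norm (integral {a..t} (f t)) \<le> integral {a..t} (\<lambda>_. M)"
      by (rule integral_norm_bound_integral[OF integrable_on_triangle_slice[OF t]])
         (use bd t in auto)
    also have "\<dots> = M * (t - a)" using t by simp
    also have "\<dots> \<le> M * (b - a)" using M t by (intro mult_left_mono) auto
    finally show ?thesis .
  qed
  then have "norm (triangle_integral a b f) \<le> integral {a..b} (\<lambda>_. M * (b - a))"
    unfolding triangle_integral_def
    by (intro integral_norm_bound_integral integrable_on_triangle) auto
  then show ?thesis using assms(1) by (simp add: power2_eq_square mult_ac)
qed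

lemma triangle_integral_add:
  fixes g :: "real \<Rightarrow> real \<Rightarrow> real"
  assumes g: "continuous_on ({a..b} \<times> {a..b}) (\<lambda>(t, s). g t s)"
  shows "triangle_integral a b (\<lambda>t s. f t s + g t s) = triangle_integral a b f + triangle_integral a b g"
proof -
  have "integral {a..b} (\<lambda>t. integral {a..t} (\<lambda>s. f t s + g t s)) =
      integral {a..b} (\<lambda>t. integral {a..t} (f t) + integral {a..t} (g t))"
  proof (rule integral_cong)
    fix t assume t: "t \<in> {a..b}"
    have "g t integrable_on {a..t}"
      by (rule integrable_continuous_real, rule continuous_on_subset[OF continuous_on_slice[OF g t]])
        (use t in auto)
    then show "integral {a..t} (\<lambda>s. f t s + g t s) = integral {a..t} (f t) + integral {a..t} (g t)"
      by (intro Henstock_Kurzweil_Integration.integral_add integrable_on_triangle_slice[OF t])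
  qed
  also have "\<dots> = triangle_integral a b f + triangle_integral a b g"
    unfolding triangle_integral_def
    by (intro Henstock_Kurzweil_Integration.integral_add integrable_on_triangle
        integrable_continuous_real[OF continuous_on_indefinite_integral_param[OF g]])
  finally show ?thesis unfolding triangle_integral_def .
qed

end

lemma triangle_integral_cong:
  assumes "\<And>t s. a \<le> s \<Longrightarrow> s \<le> t \<Longrightarrow> t \<le> b \<Longrightarrow> f t s = g t s"
  shows "triangle_integral a b f = triangle_integral a b g"
  unfolding triangle_integral_def by (intro integral_cong) (use assms in auto)

lemma triangle_integral_square_derivative:
  fixes E :: "real \<Rightarrow> real \<Rightarrow> 'a::real_inner"
  assumes "a \<le> b"
    and E: "continuous_on ({a..b} \<times> {a..b}) (\<lambda>(t, s). E t s)"
    and G: "continuous_on ({a..b} \<times> {a..b}) (\<lambda>(t, s). G t s)"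
    and H: "\<And>\<epsilon>. continuous_on ({a..b} \<times> {a..b}) (\<lambda>(t, s). H \<epsilon> t s)"
    and lim: "uniform_limit {(t, s). a \<le> s \<and> s \<le> t \<and> t \<le> b} (\<lambda>\<epsilon>. \<lambda>(t, s). H \<epsilon> t s) (\<lambda>(t, s). G t s) (at 0)"
  shows "((\<lambda>\<epsilon>. (triangle_integral a b (\<lambda>t s. (norm (E t s - \<epsilon> *\<^sub>R H \<epsilon> t s))\<^sup>2)
            - triangle_integral a b (\<lambda>t s. (norm (E t s))\<^sup>2)) / \<epsilon>)
          \<longlongrightarrow> triangle_integral a b (\<lambda>t s. - 2 * (E t s \<bullet> G t s))) (at 0)"
proof -
  let ?S = "{a..b} \<times> {a..b}" and ?T = "{(t, s). a \<le> s \<and> s \<le> t \<and> t \<le> b}"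
  note cs = E[unfolded case_prod_unfold] G[unfolded case_prod_unfold] H[unfolded case_prod_unfold]
  have TS: "?T \<subseteq> ?S" by auto
  obtain KE where KE: "KE > 0" "\<And>t s. (t, s) \<in> ?S \<Longrightarrow> norm (E t s) \<le> KE"
    using compact_imp_bounded[OF compact_continuous_image[OF E compact_Times[OF compact_Icc compact_Icc]]]
    by (fastforce simp: bounded_pos)
  obtain KG where KG: "KG > 0" "\<And>t s. (t, s) \<in> ?S \<Longrightarrow> norm (G t s) \<le> KG"
    using compact_imp_bounded[OF compact_continuous_image[OF G compact_Times[OF compact_Icc compact_Icc]]]
    by (fastforce simp: bounded_pos)
  define D where "D = (\<lambda>\<epsilon> t s. - 2 * (E t s \<bullet> (H \<epsilon> t s - G t s)) + \<epsilon> * (norm (H \<epsilon> t s))\<^sup>2)"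
  have cD: "continuous_on ?S (\<lambda>(t, s). D \<epsilon> t s)" for \<epsilon>
    unfolding D_def case_prod_unfold by (intro continuous_intros cs)
  have cEG: "continuous_on ?S (\<lambda>(t, s). - 2 * (E t s \<bullet> G t s))"
    unfolding case_prod_unfold by (intro continuous_intros cs)
  have cE2: "continuous_on ?S (\<lambda>(t, s). (norm (E t s))\<^sup>2)"
    unfolding case_prod_unfold by (intro continuous_intros cs)
  have quot: "(triangle_integral a b (\<lambda>t s. (norm (E t s - \<epsilon> *\<^sub>R H \<epsilon> t s))\<^sup>2)
            - triangle_integral a b (\<lambda>t s. (norm (E t s))\<^sup>2)) / \<epsilon>
        = triangle_integral a b (\<lambda>t s. - 2 * (E t s \<bullet> G t s)) + triangle_integral a b (D \<epsilon>)"
    if "\<epsilon> \<noteq> 0" for \<epsilon>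
  proof -
    have "(\<lambda>t s. (norm (E t s - \<epsilon> *\<^sub>R H \<epsilon> t s))\<^sup>2) =
        (\<lambda>t s. (norm (E t s))\<^sup>2 + \<epsilon> * (- 2 * (E t s \<bullet> G t s) + D \<epsilon> t s))"
      unfolding D_def power2_norm_eq_inner
      by (simp add: algebra_simps inner_commute power2_eq_square)
    moreover have "continuous_on ?S (\<lambda>(t, s). \<epsilon> * (- 2 * (E t s \<bullet> G t s) + D \<epsilon> t s))"
      using cD[of \<epsilon>] unfolding case_prod_unfold by (intro continuous_intros cs)
    moreover have "continuous_on ?S (\<lambda>(t, s). (- 2 * (E t s \<bullet> G t s) + D \<epsilon> t s))"
      using cD[of \<epsilon>] unfolding case_prod_unfold by (intro continuous_intros cs)
    ultimately show ?thesis
      using that by (simp only: triangle_integral_add[OF cE2] triangle_integral_add[OF cEG cD]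
        triangle_integral_cmult) simp
  qed
  have D0: "((\<lambda>\<epsilon>. triangle_integral a b (D \<epsilon>)) \<longlongrightarrow> 0) (at 0)"
  proof (rule tendstoI)
    fix e :: real assume e: "e > 0"
    let ?c = "2 * KE + (1 + KG)\<^sup>2" and ?q = "(b - a)\<^sup>2 + 1"
    have c: "?c > 0" using KE(1) by (intro add_pos_nonneg) auto
    have q: "?q > 0" by (intro add_nonneg_pos) auto
    define d where "d = min 1 (e / (2 * ?c * ?q))"
    have d: "d > 0" "d \<le> 1" using e c q by (auto simp: d_def)
    have "d * ?c * (b - a)\<^sup>2 \<le> d * ?c * ?q" using c d by (intro mult_left_mono) auto
    also have "\<dots> \<le> (e / (2 * ?c * ?q)) * ?c * ?q"
      using c q by (intro mult_right_mono) (auto simp: d_def)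
    also have "\<dots> = e / 2"
    proof -
      have "e / (2 * x * y) * x * y = e / 2" if "x > 0" "y > 0" for x y :: real
        using that by simp
      from this[OF c q] show ?thesis .
    qed
    finally have de: "d * ?c * (b - a)\<^sup>2 < e" using e by simp
    have "\<forall>\<^sub>F \<epsilon> in at 0. \<forall>x\<in>?T. dist (case x of (t, s) \<Rightarrow> H \<epsilon> t s) (case x of (t, s) \<Rightarrow> G t s) < d"
      by (rule uniform_limitD[OF lim d(1)])
    moreover have "\<forall>\<^sub>F \<epsilon> in at (0::real). \<bar>\<epsilon>\<bar> < d"
      using d(1) by (auto simp: eventually_at dist_norm)
    ultimately show "\<forall>\<^sub>F \<epsilon> in at 0. dist (triangle_integral a b (D \<epsilon>)) 0 < e"
    proof eventually_elim
      case (elim \<epsilon>)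
      have "\<bar>D \<epsilon> t s\<bar> \<le> d * (2 * KE + (1 + KG)\<^sup>2)" if "a \<le> s" "s \<le> t" "t \<le> b" for t s
      proof -
        have ts: "(t, s) \<in> ?S" using that by auto
        have HG: "norm (H \<epsilon> t s - G t s) \<le> d"
          using bspec[OF elim(1), of "(t, s)"] that by (simp add: dist_norm)
        have Hn: "norm (H \<epsilon> t s) \<le> 1 + KG"
          using norm_triangle_sub[of "H \<epsilon> t s" "G t s"] HG KG(2)[OF ts] d(2) by linarith
        have "\<bar>D \<epsilon> t s\<bar> \<le> 2 * \<bar>E t s \<bullet> (H \<epsilon> t s - G t s)\<bar> + \<bar>\<epsilon>\<bar> * (norm (H \<epsilon> t s))\<^sup>2"
          unfolding D_def by (rule order_trans[OF abs_triangle_ineq]) (simp add: abs_mult)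
        also have "\<dots> \<le> 2 * (KE * d) + d * (1 + KG)\<^sup>2"
        proof (intro add_mono mult_left_mono mult_mono power_mono Hn)
          have "\<bar>E t s \<bullet> (H \<epsilon> t s - G t s)\<bar> \<le> norm (E t s) * norm (H \<epsilon> t s - G t s)"
            by (rule Cauchy_Schwarz_ineq2)
          also have "\<dots> \<le> KE * d" using KE ts HG by (intro mult_mono) auto
          finally show "\<bar>E t s \<bullet> (H \<epsilon> t s - G t s)\<bar> \<le> KE * d" .
        qed (use elim(2) d in auto)
        finally show ?thesis by (simp add: algebra_simps)
      qed
      then have "\<bar>triangle_integral a b (D \<epsilon>)\<bar> \<le> d * (2 * KE + (1 + KG)\<^sup>2) * (b - a)\<^sup>2"
        by (rule abs_triangle_integral_le[OF cD assms(1)])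
      with de show ?case by simp
    qed
  qed
  have "((\<lambda>\<epsilon>. triangle_integral a b (\<lambda>t s. - 2 * (E t s \<bullet> G t s)) + triangle_integral a b (D \<epsilon>))
      \<longlongrightarrow> triangle_integral a b (\<lambda>t s. - 2 * (E t s \<bullet> G t s)) + 0) (at 0)"
    by (intro tendsto_intros D0)
  then have "((\<lambda>\<epsilon>. triangle_integral a b (\<lambda>t s. - 2 * (E t s \<bullet> G t s)) + triangle_integral a b (D \<epsilon>))
      \<longlongrightarrow> triangle_integral a b (\<lambda>t s. - 2 * (E t s \<bullet> G t s))) (at 0)"
    by (simp only: add_0_right)
  moreover have "\<forall>\<^sub>F \<epsilon> in at 0.
      triangle_integral a b (\<lambda>t s. - 2 * (E t s \<bullet> G t s)) + triangle_integral a b (D \<epsilon>) =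
      (triangle_integral a b (\<lambda>t s. (norm (E t s - \<epsilon> *\<^sub>R H \<epsilon> t s))\<^sup>2)
            - triangle_integral a b (\<lambda>t s. (norm (E t s))\<^sup>2)) / \<epsilon>"
    unfolding eventually_at_filter by (intro always_eventually allI impI quot[symmetric])
  ultimately show ?thesis by (rule Lim_transform_eventually)
qed

subsection \<open>First variation of the error\<close>

abbreviation system_kernel ::
  "real \<Rightarrow> real \<Rightarrow> (real \<Rightarrow> real^'n^'n) \<Rightarrow> (real \<Rightarrow> real^'m^'n) \<Rightarrow> (real \<Rightarrow> real^'n^'p)
    \<Rightarrow> real \<Rightarrow> real \<Rightarrow> real^'m^'p" where
  "system_kernel t0 tf A B C t s \<equiv> C t ** transition_matrix t0 tf A t s ** B s"

lemma H2_error_eq_triangle_integral: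
  "H2_error t0 tf A B C Ar Br Cr =
    triangle_integral t0 tf (\<lambda>t s. (norm (system_kernel t0 tf A B C t s - system_kernel t0 tf Ar Br Cr t s))\<^sup>2)"
  unfolding H2_error_eq_integral triangle_integral_def[symmetric]
  by (rule triangle_integral_cong) (simp add: impulse_response_def)

lemma has_functional_derivativeI:
  fixes D f :: "real \<Rightarrow> real^'b^'a"
  assumes D: "continuous_on {t0..tf} D"
    and lim: "\<And>\<Delta>. continuous_on {t0..tf} \<Delta> \<Longrightarrow>
      ((\<lambda>\<epsilon>. (F (\<lambda>t. f t + \<epsilon> *\<^sub>R \<Delta> t) - F f) / \<epsilon>) \<longlongrightarrow> integral {t0..tf} (\<lambda>t. D t \<bullet> \<Delta> t)) (at 0)"
  shows "has_functional_derivative t0 tf F f D"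
  unfolding has_functional_derivative_def trace_transpose_mult_eq_inner
proof (intro ballI conjI)
  fix \<Delta> :: "real \<Rightarrow> real^'b^'a" assume "\<Delta> \<in> cont_bdd t0 tf"
  then have c: "continuous_on {t0..tf} \<Delta>" by (simp add: cont_bdd_def)
  show "(\<lambda>t. D t \<bullet> \<Delta> t) integrable_on {t0..tf}"
    by (intro integrable_continuous_real continuous_intros D c)
  show "((\<lambda>\<epsilon>. (F (\<lambda>t. f t + \<epsilon> *\<^sub>R \<Delta> t) - F f) / \<epsilon>) \<longlongrightarrow> integral {t0..tf} (\<lambda>t. D t \<bullet> \<Delta> t)) (at 0)"
    by (rule lim[OF c])
qed

locale model_reduction =
  fixes t0 tf :: real
    and A :: "real \<Rightarrow> real^'n^'n" and B :: "real \<Rightarrow> real^'m^'n" and C :: "real \<Rightarrow> real^'n^'p"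
    and Ar :: "real \<Rightarrow> real^'r^'r" and Br :: "real \<Rightarrow> real^'m^'r" and Cr :: "real \<Rightarrow> real^'r^'p"
  assumes le: "t0 \<le> tf"
    and cont: "continuous_on {t0..tf} A" "continuous_on {t0..tf} B" "continuous_on {t0..tf} C"
      "continuous_on {t0..tf} Ar" "continuous_on {t0..tf} Br" "continuous_on {t0..tf} Cr"
begin

abbreviation "phi \<equiv> transition_matrix t0 tf A"
abbreviation "phir \<equiv> transition_matrix t0 tf Ar"
abbreviation "Pr \<equiv> gramian_Pr t0 tf Ar Br"
abbreviation "X \<equiv> gramian_X t0 tf A B Ar Br"
abbreviation "Qr \<equiv> gramian_Qr t0 tf Ar Cr"
abbreviation "Y \<equiv> gramian_Y t0 tf A C Ar Cr"

definition E :: "real \<Rightarrow> real \<Rightarrow> real^'m^'p" where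
  "E t s = system_kernel t0 tf A B C t s - system_kernel t0 tf Ar Br Cr t s"

lemma H2_error_eq_E:
  "H2_error t0 tf A B C Ar Br Cr = triangle_integral t0 tf (\<lambda>t s. (norm (E t s))\<^sup>2)"
  unfolding H2_error_eq_triangle_integral E_def ..

lemma cont_compose:
  assumes "continuous_on S f" "\<And>x. x \<in> S \<Longrightarrow> f x \<in> {t0..tf}"
  shows "continuous_on S (\<lambda>x. A (f x))" "continuous_on S (\<lambda>x. B (f x))" "continuous_on S (\<lambda>x. C (f x))"
    "continuous_on S (\<lambda>x. Ar (f x))" "continuous_on S (\<lambda>x. Br (f x))" "continuous_on S (\<lambda>x. Cr (f x))"
  using assms by (auto intro!: continuous_on_compose2[OF cont(1)] continuous_on_compose2[OF cont(2)]
      continuous_on_compose2[OF cont(3)] continuous_on_compose2[OF cont(4)]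
      continuous_on_compose2[OF cont(5)] continuous_on_compose2[OF cont(6)])

lemma cont_E: "continuous_on ({t0..tf} \<times> {t0..tf}) (\<lambda>(t, s). E t s)"
  unfolding E_def case_prod_unfold by (intro continuous_intros cont cont_compose) auto

lemma cont_E_compose:
  assumes "continuous_on S f" "continuous_on S g"
    and "\<And>x. x \<in> S \<Longrightarrow> f x \<in> {t0..tf}" "\<And>x. x \<in> S \<Longrightarrow> g x \<in> {t0..tf}"
  shows "continuous_on S (\<lambda>x. E (f x) (g x))"
  unfolding E_def using assms by (intro continuous_intros cont cont_compose)

lemma cont_gramians:
  "continuous_on {t0..tf} Pr" "continuous_on {t0..tf} X"
  "continuous_on {t0..tf} Qr" "continuous_on {t0..tf} Y"
proof -
  show "continuous_on {t0..tf} Pr" "continuous_on {t0..tf} X"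
    unfolding gramian_Pr_def gramian_X_def
    by (rule continuous_on_indefinite_integral_param, unfold case_prod_unfold,
        intro continuous_intros cont cont_compose; auto)+
  show "continuous_on {t0..tf} Qr" "continuous_on {t0..tf} Y"
    unfolding gramian_Qr_def gramian_Y_def
    by (rule continuous_on_upper_integral_param, unfold case_prod_unfold,
        intro continuous_intros cont cont_compose; auto)+
qed

lemma input_moment:
  assumes t: "t \<in> {t0..tf}" and s: "s \<in> {t0..tf}"
  shows "integral {t0..s} (\<lambda>u. E t u ** transpose (phir s u ** Br u)) =
    C t ** phi t s ** X s - Cr t ** phir t s ** Pr s"
proof -
  let ?f = "\<lambda>u. phi s u ** B u ** transpose (Br u) ** transpose (phir s u)"
  let ?g = "\<lambda>u. phir s u ** Br u ** transpose (Br u) ** transpose (phir s u)"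
  have cf: "continuous_on {t0..s} ?f" and cg: "continuous_on {t0..s} ?g"
    using s by (auto intro!: continuous_intros cont cont_compose)
  have "integral {t0..s} (\<lambda>u. E t u ** transpose (phir s u ** Br u)) =
      integral {t0..s} (\<lambda>u. (C t ** phi t s) ** ?f u - (Cr t ** phir t s) ** ?g u)"
  proof (rule integral_cong)
    fix u assume u: "u \<in> {t0..s}"
    then have u': "u \<in> {t0..tf}" using s by auto
    show "E t u ** transpose (phir s u ** Br u) = (C t ** phi t s) ** ?f u - (Cr t ** phir t s) ** ?g u"
      unfolding E_def transition_matrix_cocycle[OF cont(1) t s u', symmetric]
        transition_matrix_cocycle[OF cont(4) t s u', symmetric]
      by (simp add: matrix_mult_diff_left matrix_transpose_mul matrix_mul_assoc)
  qed
  also have "\<dots> = integral {t0..s} (\<lambda>u. (C t ** phi t s) ** ?f u) - integral {t0..s} (\<lambda>u. (Cr t ** phir t s) ** ?g u)"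
    by (intro Henstock_Kurzweil_Integration.integral_diff integrable_continuous_real
        matrix_mult_continuous_on continuous_on_const cf cg)
  also have "\<dots> = C t ** phi t s ** X s - Cr t ** phir t s ** Pr s"
    by (simp add: integral_matrix_mult_left[OF cf] integral_matrix_mult_left[OF cg]
        gramian_X_def gramian_Pr_def)
  finally show ?thesis .
qed

lemma output_moment:
  fixes M :: "real^'k^'n" and N :: "real^'k^'r"
  assumes s: "s \<in> {t0..tf}"
  shows "integral {s..tf} (\<lambda>t. transpose (Cr t ** phir t s) ** (C t ** phi t s ** M - Cr t ** phir t s ** N)) =
    transpose (Y s) ** M - Qr s ** N"
proof -
  let ?f = "\<lambda>t. transpose (phi t s) ** transpose (C t) ** Cr t ** phir t s"
  let ?g = "\<lambda>t. transpose (phir t s) ** transpose (Cr t) ** Cr t ** phir t s"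
  have cf: "continuous_on {s..tf} ?f" and cg: "continuous_on {s..tf} ?g"
    using s by (auto intro!: continuous_intros cont cont_compose)
  have "integral {s..tf} (\<lambda>t. transpose (Cr t ** phir t s) ** (C t ** phi t s ** M - Cr t ** phir t s ** N)) =
      integral {s..tf} (\<lambda>t. transpose (?f t) ** M - ?g t ** N)"
    by (simp add: matrix_mult_diff_right matrix_transpose_mul matrix_mul_assoc)
  also have "\<dots> = integral {s..tf} (\<lambda>t. transpose (?f t) ** M) - integral {s..tf} (\<lambda>t. ?g t ** N)"
    by (intro Henstock_Kurzweil_Integration.integral_diff integrable_continuous_real
        matrix_mult_continuous_on continuous_on_const cf cg transpose_continuous_on)
  also have "\<dots> = transpose (Y s) ** M - Qr s ** N"
    by (simp add: integral_matrix_mult_right[OF transpose_continuous_on[OF cf]]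
        integral_matrix_mult_right[OF cg]
        integral_bounded_linear_continuous[OF bounded_linear_transpose cf] gramian_Y_def gramian_Qr_def)
  finally show ?thesis .
qed

lemma derivative_Cr:
  "has_functional_derivative t0 tf (\<lambda>Z. H2_error t0 tf A B C Ar Br Z) Cr
     (\<lambda>t. 2 *\<^sub>R (Cr t ** Pr t - C t ** X t))"
proof (rule has_functional_derivativeI)
  show "continuous_on {t0..tf} (\<lambda>t. 2 *\<^sub>R (Cr t ** Pr t - C t ** X t))"
    by (intro continuous_intros cont cont_gramians)
  fix \<Delta> :: "real \<Rightarrow> real^'r^'p" assume cD: "continuous_on {t0..tf} \<Delta>"
  let ?G = "\<lambda>t s. system_kernel t0 tf Ar Br \<Delta> t s"
  have cG: "continuous_on ({t0..tf} \<times> {t0..tf}) (\<lambda>(t, s). ?G t s)"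
    unfolding case_prod_unfold
    by (intro continuous_intros cont cont_compose continuous_on_compose2[OF cD]) auto
  have F: "H2_error t0 tf A B C Ar Br (\<lambda>t. Cr t + \<epsilon> *\<^sub>R \<Delta> t) =
      triangle_integral t0 tf (\<lambda>t s. (norm (E t s - \<epsilon> *\<^sub>R ?G t s))\<^sup>2)" for \<epsilon>
    unfolding H2_error_eq_triangle_integral E_def
    by (simp add: matrix_mult_add_left matrix_mult_scaleR_left algebra_simps)
  have eq: "triangle_integral t0 tf (\<lambda>t s. - 2 * (E t s \<bullet> ?G t s)) =
      integral {t0..tf} (\<lambda>t. (2 *\<^sub>R (Cr t ** Pr t - C t ** X t)) \<bullet> \<Delta> t)"
    unfolding triangle_integral_def
  proof (rule integral_cong)
    fix t assume t: "t \<in> {t0..tf}"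
    have cf: "continuous_on {t0..t} (\<lambda>s. E t s ** transpose (phir t s ** Br s))"
      using t by (intro continuous_intros cont cont_compose cont_E_compose) auto
    have "integral {t0..t} (\<lambda>s. - 2 * (E t s \<bullet> ?G t s)) =
        integral {t0..t} (\<lambda>s. - 2 * (\<Delta> t \<bullet> (E t s ** transpose (phir t s ** Br s))))"
      by (simp add: inner_commute[of "E _ _"] inner_matrix_mult_right flip: matrix_mul_assoc)
    also have "\<dots> = - 2 * (\<Delta> t \<bullet> (C t ** X t - Cr t ** Pr t))"
      by (simp add: integral_bounded_linear_continuous[OF bounded_linear_inner_right cf]
          input_moment[OF t t] transition_matrix_same[OF cont(1) t] transition_matrix_same[OF cont(4) t])
    finally show "integral {t0..t} (\<lambda>s. - 2 * (E t s \<bullet> ?G t s)) = (2 *\<^sub>R (Cr t ** Pr t - C t ** X t)) \<bullet> \<Delta> t"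
      by (simp add: inner_diff_right inner_diff_left inner_commute)
  qed
  show "((\<lambda>\<epsilon>. (H2_error t0 tf A B C Ar Br (\<lambda>t. Cr t + \<epsilon> *\<^sub>R \<Delta> t) -
      H2_error t0 tf A B C Ar Br Cr) / \<epsilon>)
    \<longlongrightarrow> integral {t0..tf} (\<lambda>t. (2 *\<^sub>R (Cr t ** Pr t - C t ** X t)) \<bullet> \<Delta> t)) (at 0)"
    unfolding F H2_error_eq_E eq[symmetric]
    by (rule triangle_integral_square_derivative[OF le cont_E cG cG uniform_limit_const])
qed

lemma derivative_Br:
  "has_functional_derivative t0 tf (\<lambda>Z. H2_error t0 tf A B C Ar Z Cr) Br
     (\<lambda>t. 2 *\<^sub>R (Qr t ** Br t - transpose (Y t) ** B t))"
proof (rule has_functional_derivativeI)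
  show "continuous_on {t0..tf} (\<lambda>t. 2 *\<^sub>R (Qr t ** Br t - transpose (Y t) ** B t))"
    by (intro continuous_intros cont cont_gramians)
  fix \<Delta> :: "real \<Rightarrow> real^'m^'r" assume cD: "continuous_on {t0..tf} \<Delta>"
  let ?G = "\<lambda>t s. system_kernel t0 tf Ar \<Delta> Cr t s"
  have cG: "continuous_on ({t0..tf} \<times> {t0..tf}) (\<lambda>(t, s). ?G t s)"
    unfolding case_prod_unfold
    by (intro continuous_intros cont cont_compose continuous_on_compose2[OF cD]) auto
  have F: "H2_error t0 tf A B C Ar (\<lambda>t. Br t + \<epsilon> *\<^sub>R \<Delta> t) Cr =
      triangle_integral t0 tf (\<lambda>t s. (norm (E t s - \<epsilon> *\<^sub>R ?G t s))\<^sup>2)" for \<epsilon>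
    unfolding H2_error_eq_triangle_integral E_def
    by (simp add: matrix_mult_add_right matrix_mult_scaleR_right algebra_simps)
  have cEG: "continuous_on ({t0..tf} \<times> {t0..tf}) (\<lambda>(t, s). - 2 * (E t s \<bullet> ?G t s))"
    unfolding case_prod_unfold
    by (intro continuous_intros cont_E_compose cG[unfolded case_prod_unfold]) auto
  have "triangle_integral t0 tf (\<lambda>t s. - 2 * (E t s \<bullet> ?G t s)) =
      integral {t0..tf} (\<lambda>s. integral {s..tf} (\<lambda>t. - 2 * (E t s \<bullet> ?G t s)))"
    unfolding triangle_integral_def by (rule triangle_Fubini[OF cEG])
  also have "\<dots> = integral {t0..tf} (\<lambda>t. (2 *\<^sub>R (Qr t ** Br t - transpose (Y t) ** B t)) \<bullet> \<Delta> t)"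
  proof (rule integral_cong)
    fix s assume s: "s \<in> {t0..tf}"
    have cf: "continuous_on {s..tf} (\<lambda>t. transpose (Cr t ** phir t s) ** E t s)"
      using s by (intro continuous_intros cont cont_compose cont_E_compose) auto
    have "integral {s..tf} (\<lambda>t. - 2 * (E t s \<bullet> ?G t s)) =
        integral {s..tf} (\<lambda>t. - 2 * (\<Delta> s \<bullet> (transpose (Cr t ** phir t s) ** E t s)))"
      by (simp add: inner_commute[of "E _ _"] inner_matrix_mult_left[of "_ ** _"])
    also have "\<dots> = - 2 * (\<Delta> s \<bullet> integral {s..tf} (\<lambda>t. transpose (Cr t ** phir t s) ** E t s))"
      by (simp add: integral_bounded_linear_continuous[OF bounded_linear_inner_right cf])
    also have "\<dots> = - 2 * (\<Delta> s \<bullet> (transpose (Y s) ** B s - Qr s ** Br s))"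
      by (simp only: E_def output_moment[OF s])
    finally show "integral {s..tf} (\<lambda>t. - 2 * (E t s \<bullet> ?G t s)) = (2 *\<^sub>R (Qr s ** Br s - transpose (Y s) ** B s)) \<bullet> \<Delta> s"
      by (simp add: inner_diff_right inner_diff_left inner_commute)
  qed
  finally have eq: "triangle_integral t0 tf (\<lambda>t s. - 2 * (E t s \<bullet> ?G t s)) =
      integral {t0..tf} (\<lambda>t. (2 *\<^sub>R (Qr t ** Br t - transpose (Y t) ** B t)) \<bullet> \<Delta> t)" .
  show "((\<lambda>\<epsilon>. (H2_error t0 tf A B C Ar (\<lambda>t. Br t + \<epsilon> *\<^sub>R \<Delta> t) Cr -
      H2_error t0 tf A B C Ar Br Cr) / \<epsilon>)
    \<longlongrightarrow> integral {t0..tf} (\<lambda>t. (2 *\<^sub>R (Qr t ** Br t - transpose (Y t) ** B t)) \<bullet> \<Delta> t)) (at 0)"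
    unfolding F H2_error_eq_E eq[symmetric]
    by (rule triangle_integral_square_derivative[OF le cont_E cG cG uniform_limit_const])
qed

lemma derivative_Ar:
  "has_functional_derivative t0 tf (\<lambda>Z. H2_error t0 tf A B C Z Br Cr) Ar
     (\<lambda>t. 2 *\<^sub>R (Qr t ** Pr t - transpose (Y t) ** X t))"
proof (rule has_functional_derivativeI)
  show "continuous_on {t0..tf} (\<lambda>t. 2 *\<^sub>R (Qr t ** Pr t - transpose (Y t) ** X t))"
    by (intro continuous_intros cont cont_gramians)
  fix \<Delta> :: "real \<Rightarrow> real^'r^'r" assume cD: "continuous_on {t0..tf} \<Delta>"
  let ?T = "{(t, s). t0 \<le> s \<and> s \<le> t \<and> t \<le> tf}" and ?S = "{t0..tf} \<times> {t0..tf}"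
  define V where "V = (\<lambda>t. integral {t0..t} (\<lambda>u. phir t0 u ** \<Delta> u ** phir u t0))"
  define W where "W = (\<lambda>t s. phir t t0 ** (V t - V s) ** phir t0 s)"
  define G where "G = (\<lambda>t s. Cr t ** W t s ** Br s)"
  define q where "q = (\<lambda>\<epsilon>. transition_matrix t0 tf (\<lambda>t. Ar t + \<epsilon> *\<^sub>R \<Delta> t))"
  define H where "H = (\<lambda>\<epsilon> t s. Cr t ** ((1 / \<epsilon>) *\<^sub>R (q \<epsilon> t s - phir t s)) ** Br s)"
  have t0: "t0 \<in> {t0..tf}" using le by simp
  have cVi: "continuous_on {t0..tf} (\<lambda>u. phir t0 u ** \<Delta> u ** phir u t0)"
    using t0 by (intro continuous_intros cont cD) auto
  have cV: "continuous_on {t0..tf} V"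
    unfolding V_def by (rule indefinite_integral_continuous_1[OF integrable_continuous_real[OF cVi]])
  have cW: "continuous_on ?S (\<lambda>x. W (fst x) (snd x))"
    unfolding W_def using t0
    by (intro continuous_intros cont continuous_on_compose2[OF cV]) auto
  have cG: "continuous_on ?S (\<lambda>x. G (fst x) (snd x))"
    unfolding G_def by (intro continuous_intros cW cont_compose) auto
  have cH: "continuous_on ?S (\<lambda>x. H \<epsilon> (fst x) (snd x))" for \<epsilon>
    unfolding H_def q_def by (intro continuous_intros cont cD cont_compose) auto
  have cG': "continuous_on ?S (\<lambda>(t, s). G t s)" and cH': "continuous_on ?S (\<lambda>(t, s). H \<epsilon> t s)" for \<epsilon>
    using cG cH by (simp_all add: case_prod_unfold)
  have cvar: "continuous_on {s..t} (\<lambda>u. phir t u ** \<Delta> u ** phir u s)"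
    if "t0 \<le> s" "s \<le> t" "t \<le> tf" for s t
    using that by (intro continuous_intros cont continuous_on_subset[OF cD]) auto
  have W_eq: "W t s = integral {s..t} (\<lambda>u. phir t u ** \<Delta> u ** phir u s)"
    if ts: "t0 \<le> s" "s \<le> t" "t \<le> tf" for t s
  proof -
    have ci: "continuous_on {s..t} (\<lambda>u. phir t0 u ** \<Delta> u ** phir u t0)"
      by (rule continuous_on_subset[OF cVi]) (use ts in auto)
    have "V t - V s = integral {s..t} (\<lambda>u. phir t0 u ** \<Delta> u ** phir u t0)"
      unfolding V_def
      using Henstock_Kurzweil_Integration.integral_combine[OF ts(1,2),
          of "\<lambda>u. phir t0 u ** \<Delta> u ** phir u t0"]
        integrable_continuous_real[OF continuous_on_subset[OF cVi]] ts
      by (simp add: algebra_simps)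
    then have "W t s = integral {s..t} (\<lambda>u. phir t t0 ** (phir t0 u ** \<Delta> u ** phir u t0) ** phir t0 s)"
      unfolding W_def using ci
      by (simp add: integral_matrix_mult_left integral_matrix_mult_right matrix_mult_continuous_on)
    also have "\<dots> = integral {s..t} (\<lambda>u. phir t u ** \<Delta> u ** phir u s)"
    proof (rule integral_cong)
      fix u assume "u \<in> {s..t}"
      then have mem: "t \<in> {t0..tf}" "u \<in> {t0..tf}" "s \<in> {t0..tf}" using ts by auto
      have "phir t t0 ** (phir t0 u ** \<Delta> u ** phir u t0) ** phir t0 s =
          (phir t t0 ** phir t0 u) ** \<Delta> u ** (phir u t0 ** phir t0 s)"
        by (simp add: matrix_mul_assoc)
      then show "phir t t0 ** (phir t0 u ** \<Delta> u ** phir u t0) ** phir t0 s = phir t u ** \<Delta> u ** phir u s"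
        by (simp only: transition_matrix_cocycle[OF cont(4)] mem t0)
    qed
    finally show ?thesis .
  qed
  have lim: "uniform_limit ?T (\<lambda>\<epsilon> (t, s). H \<epsilon> t s) (\<lambda>(t, s). G t s) (at 0)"
  proof -
    have bdd: "bounded (f ` ?T)" if "continuous_on ?S f" for f :: "real \<times> real \<Rightarrow> 'c::metric_space"
      by (rule bounded_subset[OF compact_imp_bounded[OF compact_continuous_image[OF that]]])
         (auto intro!: compact_Times imageI)
    have cCB: "continuous_on ?S (\<lambda>x. Cr (fst x))" "continuous_on ?S (\<lambda>x. Br (snd x))"
      by (intro cont_compose continuous_intros; auto)+
    have "uniform_limit ?T (\<lambda>\<epsilon> x. (1 / \<epsilon>) *\<^sub>R (q \<epsilon> (fst x) (snd x) - phir (fst x) (snd x)))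
        (\<lambda>x. W (fst x) (snd x)) (at 0)"
      using transition_matrix_first_variation[OF le cont(4) cD]
      by (rule uniform_limit_cong'[THEN iffD1, rotated -1]) (auto simp: q_def W_eq)
    then have "uniform_limit ?T (\<lambda>\<epsilon> x. H \<epsilon> (fst x) (snd x)) (\<lambda>x. G (fst x) (snd x)) (at 0)"
      unfolding H_def G_def
      by (intro bounded_bilinear.bounded_uniform_limit[OF bounded_bilinear_matrix_mult]
          uniform_limit_const bdd matrix_mult_continuous_on cW cCB)
    then show ?thesis by (simp add: case_prod_unfold)
  qed
  have F: "H2_error t0 tf A B C (\<lambda>t. Ar t + \<epsilon> *\<^sub>R \<Delta> t) Br Cr =
      triangle_integral t0 tf (\<lambda>t s. (norm (E t s - \<epsilon> *\<^sub>R H \<epsilon> t s))\<^sup>2)" for \<epsilon>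
  proof (cases "\<epsilon> = 0")
    case False
    then show ?thesis
      unfolding H2_error_eq_triangle_integral E_def H_def q_def
      by (simp add: matrix_mult_scaleR_left matrix_mult_scaleR_right
          matrix_mult_diff_left matrix_mult_diff_right algebra_simps)
  qed (simp add: H2_error_eq_triangle_integral E_def)
  \<comment> \<open>\<open>h t u\<close> is what remains of the integrand at \<open>t \<ge> u \<ge> s\<close> after integrating out the input time \<open>s\<close>.\<close>
  define h where "h = (\<lambda>t u. - 2 * (\<Delta> u \<bullet>
    (transpose (Cr t ** phir t u) ** (C t ** phi t u ** X u - Cr t ** phir t u ** Pr u))))"
  have inner: "integral {t0..t} (\<lambda>s. - 2 * (E t s \<bullet> G t s)) = integral {t0..t} (h t)"
    if t: "t \<in> {t0..tf}" for t
  proof -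
    define f where "f = (\<lambda>u s. - 2 * (\<Delta> u \<bullet>
      (transpose (Cr t ** phir t u) ** (E t s ** transpose (phir u s ** Br s)))))"
    have "continuous_on ({t0..t} \<times> {t0..t}) (\<lambda>x. f (fst x) (snd x))"
      unfolding f_def using t
      by (intro continuous_intros cont cont_compose cont_E_compose continuous_on_compose2[OF cD]) auto
    then have cf: "continuous_on ({t0..t} \<times> {t0..t}) (\<lambda>(u, s). f u s)"
      by (simp add: case_prod_unfold)
    have "integral {t0..t} (\<lambda>s. - 2 * (E t s \<bullet> G t s)) = integral {t0..t} (\<lambda>s. integral {s..t} (\<lambda>u. f u s))"
    proof (rule integral_cong)
      fix s assume "s \<in> {t0..t}"
      then have ts: "t0 \<le> s" "s \<le> t" "t \<le> tf" using t by auto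
      have bl: "bounded_linear (\<lambda>M. - 2 * (E t s \<bullet> (Cr t ** M ** Br s)))"
        by (intro bounded_linear_mult_right[THEN bounded_linear_compose]
            bounded_linear_inner_right[THEN bounded_linear_compose]
            bounded_bilinear.bounded_linear_left[OF bounded_bilinear_matrix_mult, THEN bounded_linear_compose]
            bounded_bilinear.bounded_linear_right[OF bounded_bilinear_matrix_mult])
      have "- 2 * (E t s \<bullet> G t s) =
          integral {s..t} (\<lambda>u. - 2 * (E t s \<bullet> (Cr t ** (phir t u ** \<Delta> u ** phir u s) ** Br s)))"
        unfolding G_def W_eq[OF ts]
        by (rule integral_bounded_linear_continuous[OF bl cvar[OF ts], symmetric])
      also have "\<dots> = integral {s..t} (\<lambda>u. f u s)"
      proof -
        have "M \<bullet> (Cr t ** (P ** D ** Q) ** N) = D \<bullet> (transpose (Cr t ** P) ** (M ** transpose (Q ** N)))"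
          for M :: "real^'m^'p" and P D Q :: "real^'r^'r" and N :: "real^'m^'r"
        proof -
          have eq: "Cr t ** (P ** D ** Q) ** N = (Cr t ** P) ** (D ** (Q ** N))"
            by (simp add: matrix_mul_assoc)
          show ?thesis
            unfolding eq inner_commute[of M] inner_matrix_mult_left[of "Cr t ** P"]
              inner_matrix_mult_right[of D] by (simp only: matrix_mul_assoc)
        qed
        then show ?thesis unfolding f_def by simp
      qed
      finally show "- 2 * (E t s \<bullet> G t s) = integral {s..t} (\<lambda>u. f u s)" .
    qed
    also have "\<dots> = integral {t0..t} (\<lambda>u. integral {t0..u} (f u))"
      by (rule triangle_Fubini[OF cf, symmetric])
    also have "\<dots> = integral {t0..t} (h t)"
    proof (rule integral_cong)
      fix u assume u: "u \<in> {t0..t}"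
      then have u': "u \<in> {t0..tf}" using t by auto
      have ce: "continuous_on {t0..u} (\<lambda>s. E t s ** transpose (phir u s ** Br s))"
        using t u by (intro continuous_intros cont cont_compose cont_E_compose) auto
      have bl: "bounded_linear (\<lambda>M. - 2 * (\<Delta> u \<bullet> (transpose (Cr t ** phir t u) ** M)))"
        by (intro bounded_linear_mult_right[THEN bounded_linear_compose]
            bounded_linear_inner_right[THEN bounded_linear_compose]
            bounded_bilinear.bounded_linear_right[OF bounded_bilinear_matrix_mult])
      show "integral {t0..u} (f u) = h t u"
        unfolding f_def h_def integral_bounded_linear_continuous[OF bl ce] input_moment[OF t u'] ..
    qed
    finally show ?thesis .
  qed
  have "continuous_on ?S (\<lambda>x. h (fst x) (snd x))"
    unfolding h_def
    by (intro continuous_intros cont cont_compose continuous_on_compose2[OF cD]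
        continuous_on_compose2[OF cont_gramians(1)] continuous_on_compose2[OF cont_gramians(2)]) auto
  then have ch: "continuous_on ?S (\<lambda>(t, u). h t u)" by (simp add: case_prod_unfold)
  have "triangle_integral t0 tf (\<lambda>t s. - 2 * (E t s \<bullet> G t s)) = integral {t0..tf} (\<lambda>t. integral {t0..t} (h t))"
    unfolding triangle_integral_def by (rule integral_cong) (rule inner)
  also have "\<dots> = integral {t0..tf} (\<lambda>u. integral {u..tf} (\<lambda>t. h t u))"
    by (rule triangle_Fubini[OF ch])
  also have "\<dots> = integral {t0..tf} (\<lambda>t. (2 *\<^sub>R (Qr t ** Pr t - transpose (Y t) ** X t)) \<bullet> \<Delta> t)"
  proof (rule integral_cong)
    fix u assume u: "u \<in> {t0..tf}"
    have ce: "continuous_on {u..tf} (\<lambda>t. transpose (Cr t ** phir t u) **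
        (C t ** phi t u ** X u - Cr t ** phir t u ** Pr u))"
      using u by (intro continuous_intros cont cont_compose) auto
    have bl: "bounded_linear (\<lambda>M. - 2 * (\<Delta> u \<bullet> M))"
      by (intro bounded_linear_mult_right[THEN bounded_linear_compose] bounded_linear_inner_right)
    have "integral {u..tf} (\<lambda>t. h t u) = - 2 * (\<Delta> u \<bullet> (transpose (Y u) ** X u - Qr u ** Pr u))"
      unfolding h_def integral_bounded_linear_continuous[OF bl ce] output_moment[OF u] ..
    then show "integral {u..tf} (\<lambda>t. h t u) = (2 *\<^sub>R (Qr u ** Pr u - transpose (Y u) ** X u)) \<bullet> \<Delta> u"
      by (simp add: inner_diff_right inner_diff_left inner_commute)
  qed
  finally have eq: "triangle_integral t0 tf (\<lambda>t s. - 2 * (E t s \<bullet> G t s)) =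
      integral {t0..tf} (\<lambda>t. (2 *\<^sub>R (Qr t ** Pr t - transpose (Y t) ** X t)) \<bullet> \<Delta> t)" .
  show "((\<lambda>\<epsilon>. (H2_error t0 tf A B C (\<lambda>t. Ar t + \<epsilon> *\<^sub>R \<Delta> t) Br Cr -
      H2_error t0 tf A B C Ar Br Cr) / \<epsilon>)
    \<longlongrightarrow> integral {t0..tf} (\<lambda>t. (2 *\<^sub>R (Qr t ** Pr t - transpose (Y t) ** X t)) \<bullet> \<Delta> t)) (at 0)"
    unfolding F H2_error_eq_E eq[symmetric]
    by (rule triangle_integral_square_derivative[OF le cont_E cG' cH' lim])
qed

end

theorem theorem6:
  fixes t0 tf :: real
    and A :: "real \<Rightarrow> real^'n^'n"
    and B :: "real \<Rightarrow> real^'m^'n"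
    and C :: "real \<Rightarrow> real^'n^'p"
    and Ar :: "real \<Rightarrow> real^'r^'r"
    and Br :: "real \<Rightarrow> real^'m^'r"
    and Cr :: "real \<Rightarrow> real^'r^'p"
  assumes "t0 < tf"
    and "CARD('r) < CARD('n)"
    and "A \<in> cont_bdd t0 tf" and "B \<in> cont_bdd t0 tf" and "C \<in> cont_bdd t0 tf"
    and "Ar \<in> cont_bdd t0 tf" and "Br \<in> cont_bdd t0 tf" and "Cr \<in> cont_bdd t0 tf"
  shows "has_functional_derivative t0 tf (\<lambda>Z. H2_error t0 tf A B C Z Br Cr) Ar
           (\<lambda>t. 2 *\<^sub>R (gramian_Qr t0 tf Ar Cr t ** gramian_Pr t0 tf Ar Br t
                     - transpose (gramian_Y t0 tf A C Ar Cr t) ** gramian_X t0 tf A B Ar Br t))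
       \<and> has_functional_derivative t0 tf (\<lambda>Z. H2_error t0 tf A B C Ar Z Cr) Br
           (\<lambda>t. 2 *\<^sub>R (gramian_Qr t0 tf Ar Cr t ** Br t
                     - transpose (gramian_Y t0 tf A C Ar Cr t) ** B t))
       \<and> has_functional_derivative t0 tf (\<lambda>Z. H2_error t0 tf A B C Ar Br Z) Cr
           (\<lambda>t. 2 *\<^sub>R (Cr t ** gramian_Pr t0 tf Ar Br t
                     - C t ** gramian_X t0 tf A B Ar Br t))"
proof -
  interpret model_reduction t0 tf A B C Ar Br Cr
    using assms by unfold_locales (auto simp: cont_bdd_def)
  show ?thesis using derivative_Ar derivative_Br derivative_Cr by blast
qed

end
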